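(* Let $1\le p<\infty$, let $u$ be an analytic function on the open unit disk $\mathbb{D}$ and $\varphi$ an analytic self-map of $\mathbb{D}$. For $g$ analytic on $\mathbb{D}$ and $z\in\mathbb{D}$ put $$I_ug(z)=\int_0^zg'(\xi)u(\xi)\,d\xi,\qquad J_ug(z)=\int_0^zg(\xi)u'(\xi)\,d\xi.$$ Then the following statements hold. (a) The weighted composition operator $uC_\varphi:H^p\to\mathcal{B}$ is bounded if and only if $$\sup_{j\ge1}j^{1/p}\|I_u(\varphi^j)\|_{\mathcal{B}}<\infty\quad\text{and}\quad\sup_{j\ge1}j^{1/p}\|J_u(\varphi^{j-1})\|_{\mathcal{B}}<\infty.$$ (b) If $uC_\varphi:H^p\to\mathcal{B}$ is bounded, then $uC_\varphi:H^p\to\mathcal{B}$ is compact if and only if $$\limsup_{j\to\infty}j^{1/p}\|I_u(\varphi^j)\|_{\mathcal{B}}=0\quad\text{and}\quad\limsup_{j\to\infty}j^{1/p}\|J_u(\varphi^{j-1})\|_{\mathcal{B}}=0.$$ Moreover (still when $uC_\varphi:H^p\to\mathcal{B}$ is bounded), $$\|uC_\varphi\|_{e,H^p\to\mathcal{B}}\approx\max\Big\{\limsup_{j\to\infty}j^{1/p}\|I_u(\varphi^j)\|_{\mathcal{B}},\ \limsup_{j\to\infty}j^{1/p}\|J_u(\varphi^{j-1})\|_{\mathcal{B}}\Big\}.$$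
   Context: $H(\mathbb{D})$ is the space of analytic functions on the open unit disk $\mathbb{D}\subset\mathbb{C}$. For $u\in H(\mathbb{D})$ and an analytic $\varphi:\mathbb{D}\to\mathbb{D}$, the weighted composition operator is $(uC_\varphi f)(z)=u(z)f(\varphi(z))$, $f\in H(\mathbb{D})$. The Hardy space $H^p$ consists of all $f\in H(\mathbb{D})$ with $\|f\|_{H^p}^p=\sup_{0<r<1}\frac{1}{2\pi}\int_0^{2\pi}|f(re^{i\theta})|^p\,d\theta<\infty$. The Bloch space $\mathcal{B}$ consists of all $f\in H(\mathbb{D})$ with $\sup_{z\in\mathbb{D}}(1-|z|^2)|f'(z)|<\infty$, with norm $\|f\|_{\mathcal{B}}=|f(0)|+\sup_{z\in\mathbb{D}}(1-|z|^2)|f'(z)|$ (this expression equals $\infty$ if $f\notin\mathcal{B}$). The essential norm of a bounded linear operator $T:X\to Y$ between Banach spaces is $\|T\|_{e,X\to Y}=\inf\{\|T-K\|_{X\to Y}: K:X\to Y \text{ compact}\}$. $\varphi^j$ denotes the $j$-th pointwise power of $\varphi$ (not an iterate), with $\varphi^0=1$; $j$ ranges over positive integers. $X\lesssim Y$ means that there exists a constant $C$ such that $X\le CY$, and $X\approx Y$ means $X\lesssim Y\lesssim X$. *)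

theory Defs
  imports "HOL-Complex_Analysis.Complex_Analysis"
begin

abbreviation unit_disc :: "complex set" where
  "unit_disc \<equiv> ball 0 1"

text \<open>
  Analytic functions on the disc are total functions that are holomorphic on the disc. Their
  values off the disc are irrelevant: no norm below depends on them, and operators are required to
  be linear only up to equality on the disc. A space is determined by its norm, which takes values in
  \<^typ>\<open>ennreal\<close>: it consists of the analytic functions of finite norm.
\<close>

definition fspace :: "((complex \<Rightarrow> complex) \<Rightarrow> ennreal) \<Rightarrow> (complex \<Rightarrow> complex) set" where
  "fspace N = {f. f holomorphic_on unit_disc \<and> N f < \<infinity>}"

definition hardy_norm_pow :: "real \<Rightarrow> (complex \<Rightarrow> complex) \<Rightarrow> ennreal" where
  "hardy_norm_pow p f =
    (SUP r\<in>{0<..<1}.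
       ennreal (1 / (2 * pi) * integral {0..2*pi} (\<lambda>\<theta>. norm (f (of_real r * cis \<theta>)) powr p)))"

text \<open>The \<open>p\<close>-th root of the previous quantity; there is no real power on \<^typ>\<open>ennreal\<close>.\<close>

definition hardy_norm :: "real \<Rightarrow> (complex \<Rightarrow> complex) \<Rightarrow> ennreal" where
  "hardy_norm p f =
    (if hardy_norm_pow p f = \<infinity> then \<infinity>
     else ennreal (enn2real (hardy_norm_pow p f) powr (1 / p)))"

definition bloch_norm :: "(complex \<Rightarrow> complex) \<Rightarrow> ennreal" where
  "bloch_norm f =
    ennreal (norm (f 0)) + (SUP z\<in>unit_disc. ennreal ((1 - (norm z)\<^sup>2) * norm (deriv f z)))"

text \<open>Linear maps from the space with norm \<open>N\<close> to the space with norm \<open>M\<close>.\<close>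

definition linear_op ::
  "((complex \<Rightarrow> complex) \<Rightarrow> ennreal) \<Rightarrow> ((complex \<Rightarrow> complex) \<Rightarrow> ennreal) \<Rightarrow>
   ((complex \<Rightarrow> complex) \<Rightarrow> (complex \<Rightarrow> complex)) \<Rightarrow> bool" where
  "linear_op N M T \<longleftrightarrow>
    (\<forall>f\<in>fspace N. T f \<in> fspace M) \<and>
    (\<forall>f\<in>fspace N. \<forall>g\<in>fspace N. \<forall>z\<in>unit_disc. T (\<lambda>w. f w + g w) z = T f z + T g z) \<and>
    (\<forall>c. \<forall>f\<in>fspace N. \<forall>z\<in>unit_disc. T (\<lambda>w. c * f w) z = c * T f z)"

definition bounded_op ::
  "((complex \<Rightarrow> complex) \<Rightarrow> ennreal) \<Rightarrow> ((complex \<Rightarrow> complex) \<Rightarrow> ennreal) \<Rightarrow>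
   ((complex \<Rightarrow> complex) \<Rightarrow> (complex \<Rightarrow> complex)) \<Rightarrow> bool" where
  "bounded_op N M T \<longleftrightarrow>
    linear_op N M T \<and> (\<exists>C::real. \<forall>f\<in>fspace N. M (T f) \<le> ennreal C * N f)"

text \<open>Compactness: the image of the unit ball is relatively (sequentially) compact.\<close>

definition compact_op ::
  "((complex \<Rightarrow> complex) \<Rightarrow> ennreal) \<Rightarrow> ((complex \<Rightarrow> complex) \<Rightarrow> ennreal) \<Rightarrow>
   ((complex \<Rightarrow> complex) \<Rightarrow> (complex \<Rightarrow> complex)) \<Rightarrow> bool" where
  "compact_op N M T \<longleftrightarrow>
    linear_op N M T \<and>
    (\<forall>F :: nat \<Rightarrow> complex \<Rightarrow> complex. (\<forall>n. F n \<in> fspace N \<and> N (F n) \<le> 1) \<longrightarrow>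
      (\<exists>g\<in>fspace M. \<exists>s :: nat \<Rightarrow> nat. strict_mono s \<and>
        (\<lambda>n. M (\<lambda>z. T (F (s n)) z - g z)) \<longlonglongrightarrow> 0))"

definition op_norm ::
  "((complex \<Rightarrow> complex) \<Rightarrow> ennreal) \<Rightarrow> ((complex \<Rightarrow> complex) \<Rightarrow> ennreal) \<Rightarrow>
   ((complex \<Rightarrow> complex) \<Rightarrow> (complex \<Rightarrow> complex)) \<Rightarrow> ennreal" where
  "op_norm N M T = (SUP f\<in>{f \<in> fspace N. N f \<le> 1}. M (T f))"

definition ess_norm ::
  "((complex \<Rightarrow> complex) \<Rightarrow> ennreal) \<Rightarrow> ((complex \<Rightarrow> complex) \<Rightarrow> ennreal) \<Rightarrow>
   ((complex \<Rightarrow> complex) \<Rightarrow> (complex \<Rightarrow> complex)) \<Rightarrow> ennreal" where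
  "ess_norm N M T = (INF K\<in>{K. compact_op N M K}. op_norm N M (\<lambda>f z. T f z - K f z))"

definition weighted_comp ::
  "(complex \<Rightarrow> complex) \<Rightarrow> (complex \<Rightarrow> complex) \<Rightarrow> (complex \<Rightarrow> complex) \<Rightarrow> complex \<Rightarrow> complex" where
  "weighted_comp u \<phi> f = (\<lambda>z. u z * f (\<phi> z))"

definition I_op :: "(complex \<Rightarrow> complex) \<Rightarrow> (complex \<Rightarrow> complex) \<Rightarrow> complex \<Rightarrow> complex" where
  "I_op u g z = contour_integral (linepath 0 z) (\<lambda>\<xi>. deriv g \<xi> * u \<xi>)"

definition J_op :: "(complex \<Rightarrow> complex) \<Rightarrow> (complex \<Rightarrow> complex) \<Rightarrow> complex \<Rightarrow> complex" where
  "J_op u g z = contour_integral (linepath 0 z) (\<lambda>\<xi>. g \<xi> * deriv u \<xi>)"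

end

theory Submission
  imports Defs
begin

text \<open>
  Since \<open>j powr s * x ^ (j - 1)\<close>, maximised over \<open>j\<close>, is comparable to \<open>(1 - x) powr - s\<close>, the two
  suprema over \<open>j\<close> control the weights \<open>(1 - |z|\<^sup>2) |u'(z)| / (1 - |\<phi>(z)|) powr (1/p)\<close> and
  \<open>(1 - |z|\<^sup>2) |u(z) \<phi>'(z)| / (1 - |\<phi>(z)|) powr (1 + 1/p)\<close> on the disc, and the two upper limits
  control them as \<open>|\<phi>(z)| \<rightarrow> 1\<close>. Upper bounds follow from the growth of \<open>H\<^sup>p\<close> functions and of their
  derivatives, applied to \<open>f\<close> and to \<open>f - f(r \<cdot>)\<close>; the operators \<open>f \<mapsto> u \<cdot> f(r \<phi>)\<close> are compact by
  Montel's theorem. Lower bounds follow from test functions built from the Poisson kernel that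
  isolate the value or the derivative at \<open>\<phi>(z)\<close>.
\<close>

section \<open>Suprema of powers\<close>

text \<open>By the product rule, \<open>(T f)' = u' f(\<phi>) + u \<phi>' f'(\<phi>)\<close>, and
  the coefficients \<open>u'\<close> and \<open>u \<phi>'\<close> are also what \<open>J_op\<close>
  and \<open>I_op\<close> leave after differentiation. Differentiating \<open>\<phi> ^ j\<close>
  brings down a factor \<open>j\<close>, which is why the weight on \<open>u \<phi>'\<close> has the
  exponent 1 + 1/p and the weight on \<open>u'\<close> only 1/p. An upper bound may treat the two
  summands separately. A lower bound may not, since they could cancel; hence two families of test
  functions, one with vanishing value and one with vanishing derivative at the point
  \<open>\<phi> z\<close>. A lower bound for \<open>T - K\<close> with \<open>K\<close> compact
  compares two test functions and so uses the norm of \<open>T - K\<close> twice; this is the source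
  of the term \<open>2 * E\<close>. The equivalence of the essential norm must have one constant for
  all \<open>u\<close> and \<open>\<phi>\<close>. Therefore every quantity that depends on them,
  such as \<open>norm (u 0)\<close> or a global bound \<open>M\<close> of the weights, is only
  allowed to multiply something that is then made arbitrarily small; the constants that survive
  depend on \<open>p\<close> alone.\<close>

lemma powr_le_exp:
  fixes s t :: real
  assumes "0 < s" "0 \<le> t"
  shows "t powr s \<le> s powr s * exp t"
proof -
  have "t / s \<le> exp (t / s)"
    by (rule order_trans[OF _ exp_ge_add_one_self]) simp
  then have "(t / s) powr s \<le> exp (t / s) powr s"
    using assms by (intro powr_mono2) auto
  also have "exp (t / s) powr s = exp t"
    using assms by (simp add: powr_def)
  finally show ?thesis
    using assms by (simp add: powr_divide field_simps)
qed

lemma powr_mult_powr_minus: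
  fixes x s :: real
  assumes "x < 1"
  shows "(1 - x) powr s * (1 - x) powr - s = 1"
  using assms by (simp flip: powr_add)

text \<open>Used with \<open>q = (1 - x) powr s\<close> and \<open>q' = (1 - x) powr - s\<close>, to
  cancel this pair inside longer products.\<close>

lemma mult_cancel_unit:
  fixes q q' :: "'a :: comm_monoid_mult"
  assumes "q * q' = 1"
  shows "a * b * q * (c * q') = a * (c * b)" "c * q' * (d * q * (a * b)) = d * (a * (c * b))"
proof -
  have "a * b * q * (c * q') = a * (c * b) * (q * q')"
    by (simp only: mult_ac)
  then show "a * b * q * (c * q') = a * (c * b)" using assms by simp
  have "c * q' * (d * q * (a * b)) = d * (a * (c * b)) * (q * q')"
    by (simp only: mult_ac)
  then show "c * q' * (d * q * (a * b)) = d * (a * (c * b))" using assms by simp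
qed

text \<open>With \<open>y = 1 - x\<close>, the inequality \<open>x \<le> exp (- y)\<close> gives
  \<open>x ^ (j - 1) \<le> exp 1 * exp (- j y)\<close>, the factor \<open>exp 1\<close> paying for
  the shift by one. What remains is \<open>t powr s * exp (- t)\<close> at \<open>t = j y\<close>,
  which is at most \<open>s powr s\<close>.\<close>

lemma powr_power_upper:
  fixes x s :: real and j :: nat
  assumes "0 \<le> x" "x < 1" "0 < s" "1 \<le> j"
  shows "real j powr s * x ^ (j - 1) * (1 - x) powr s \<le> exp 1 * s powr s"
proof -
  let ?y = "1 - x"
  have "x ^ (j - 1) \<le> exp (- ?y) ^ (j - 1)"
    using assms exp_ge_add_one_self[of "- ?y"] by (intro power_mono) auto
  also have "\<dots> = exp (?y - real j * ?y)"
    using assms by (simp add: exp_of_nat_mult[symmetric] algebra_simps)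
  also have "\<dots> \<le> exp (1 - real j * ?y)"
    using assms by simp
  finally have 1: "x ^ (j - 1) \<le> exp 1 * exp (- (real j * ?y))"
    using exp_add[of 1 "- (real j * ?y)"] by simp
  have "real j powr s * x ^ (j - 1) * ?y powr s = (real j * ?y) powr s * x ^ (j - 1)"
    using assms by (simp add: powr_mult)
  also have "\<dots> \<le> (s powr s * exp (real j * ?y)) * (exp 1 * exp (- (real j * ?y)))"
    using assms 1 by (intro mult_mono powr_le_exp) auto
  also have "\<dots> = exp 1 * s powr s"
    by (simp add: exp_minus)
  finally show ?thesis .
qed

text \<open>The choice \<open>j \<approx> 1 / (1 - x)\<close> makes \<open>x ^ (j - 1)\<close> bounded below and
  \<open>j powr s\<close> comparable to \<open>(1 - x) powr - s\<close>.\<close>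

lemma powr_power_lower:
  fixes x s :: real
  assumes "0 \<le> x" "x < 1" "0 < s" and j: "j = nat \<lfloor>1 / (1 - x)\<rfloor>"
  shows "1 \<le> exp 1 * 2 powr s * (1 - x) powr s * (real j powr s * x ^ (j - 1))"
proof -
  let ?y = "1 - x"
  have y: "0 < ?y" "?y \<le> 1" using assms by auto
  have jr: "real j = of_int \<lfloor>1 / ?y\<rfloor>"
    using y unfolding j by (simp add: of_nat_nat)
  have j_le: "real j \<le> 1 / ?y"
    unfolding jr by linarith
  have j_gt: "1 / ?y < real j + 1"
    unfolding jr by linarith
  have j1: "1 \<le> j"
    using y unfolding j by (simp add: le_nat_iff le_floor_iff)
  \<comment> \<open>Rounding down loses at most a factor 2:
    \<open>1 / y < j + 1 \<le> 2 j\<close>.\<close>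
  have "1 \<le> 2 * real j * ?y"
  proof -
    have "1 < (real j + 1) * ?y" using j_gt y by (simp add: divide_less_eq)
    also have "\<dots> \<le> (2 * real j) * ?y" using j1 y by (intro mult_right_mono) auto
    finally show ?thesis by simp
  qed
  then have "1 \<le> (2 * real j * ?y) powr s"
    using assms by (intro ge_one_powr_ge_zero) auto
  then have 1: "1 \<le> 2 powr s * ?y powr s * real j powr s"
    using y powr_mult[of 2 "real j * ?y" s] powr_mult[of "real j" ?y s] by (simp add: mult_ac)
  \<comment> \<open>With \<open>k = j - 1 > 0\<close>, the bound \<open>j \<le> 1 / y\<close> means
    \<open>x \<ge> k / (k + 1)\<close>, so \<open>1 / x \<le> 1 + 1 / k \<le> exp (1 / k)\<close>;
    then raise to the power \<open>k\<close>.\<close>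
  have "1 \<le> exp 1 * x ^ (j - 1)"
  proof (cases "j = 1")
    case False
    define k where "k = j - 1"
    have k: "0 < k" "real j = real k + 1" using j1 False unfolding k_def by auto
    have "?y \<le> 1 / (real k + 1)" using j_le k y by (simp add: field_simps)
    then have k_le: "real k / (real k + 1) \<le> x"
      using k by (simp add: field_simps)
    then have xpos: "0 < x" and inv: "inverse x \<le> 1 + 1 / real k"
    proof -
      have "0 < real k / (real k + 1)" using k by simp
      then show "0 < x" using k_le by linarith
      then show "inverse x \<le> 1 + 1 / real k"
        using k_le k by (simp add: field_simps)
    qed
    have "inverse x \<le> exp (1 / real k)"
      using inv exp_ge_add_one_self[of "1 / real k"] by linarith
    then have "inverse x ^ k \<le> exp (1 / real k) ^ k"
      using xpos by (intro power_mono) auto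
    also have "\<dots> = exp 1"
      using k by (simp add: exp_of_nat_mult[symmetric])
    finally show ?thesis
      using xpos by (simp add: k_def power_inverse field_simps)
  qed simp
  then have "1 * 1 \<le> (2 powr s * ?y powr s * real j powr s) * (exp 1 * x ^ (j - 1))"
    using 1 by (intro mult_mono) auto
  then show ?thesis by (simp add: mult_ac)
qed

text \<open>The two suprema are never interchanged: for the bound at \<open>z\<close> a single index
  \<open>j\<close>, chosen from \<open>x z\<close>, is enough, and conversely the upper estimate is
  uniform in \<open>j\<close> and \<open>z\<close>. Later \<open>x z\<close> is
  \<open>norm (\<phi> z)\<close>.\<close>

lemma SUP_powr_power_finite_iff:
  fixes W x :: "'a \<Rightarrow> real"
  assumes s: "0 < s" and W: "\<And>z. z \<in> S \<Longrightarrow> 0 \<le> W z"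
    and x: "\<And>z. z \<in> S \<Longrightarrow> 0 \<le> x z \<and> x z < 1"
  shows "(SUP j\<in>{1::nat..}. SUP z\<in>S. ennreal (real j powr s * (W z * x z ^ (j - 1)))) < \<infinity> \<longleftrightarrow>
    (\<exists>B\<ge>0. \<forall>z\<in>S. W z * (1 - x z) powr - s \<le> B)"
    (is "?S < \<infinity> \<longleftrightarrow> _")
proof
  assume fin: "?S < \<infinity>"
  define B where "B = enn2real ?S"
  have B: "ennreal B = ?S" and B0: "0 \<le> B" using fin unfolding B_def by auto
  have "W z * (1 - x z) powr - s \<le> exp 1 * 2 powr s * B" if z: "z \<in> S" for z
  proof -
    define j where "j = nat \<lfloor>1 / (1 - x z)\<rfloor>"
    have j1: "1 \<le> j" using x[OF z] unfolding j_def by (simp add: le_nat_iff le_floor_iff)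
    have "ennreal (real j powr s * (W z * x z ^ (j - 1))) \<le> ?S"
      using j1 z by (intro SUP_upper2[of j] SUP_upper) auto
    then have le: "real j powr s * (W z * x z ^ (j - 1)) \<le> B"
      unfolding B[symmetric] using B0 by simp
    have "W z * (1 - x z) powr - s * 1 \<le> W z * (1 - x z) powr - s *
        (exp 1 * 2 powr s * (1 - x z) powr s * (real j powr s * x z ^ (j - 1)))"
      using x[OF z] W[OF z] s by (intro mult_left_mono powr_power_lower[OF _ _ _ j_def]) auto
    also have "\<dots> = exp 1 * 2 powr s * (real j powr s * (W z * x z ^ (j - 1)))"
      by (rule mult_cancel_unit(2)[OF powr_mult_powr_minus[OF x[OF z, THEN conjunct2]]])
    also have "\<dots> \<le> exp 1 * 2 powr s * B"
      using le by (intro mult_left_mono) auto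
    finally show ?thesis by simp
  qed
  moreover have "0 \<le> exp 1 * 2 powr s * B" using B0 by simp
  ultimately show "\<exists>B\<ge>0. \<forall>z\<in>S. W z * (1 - x z) powr - s \<le> B" by blast
next
  assume "\<exists>B\<ge>0. \<forall>z\<in>S. W z * (1 - x z) powr - s \<le> B"
  then obtain B where B: "0 \<le> B" "\<And>z. z \<in> S \<Longrightarrow> W z * (1 - x z) powr - s \<le> B" by blast
  have "?S \<le> ennreal (exp 1 * s powr s * B)"
  proof (intro SUP_least ennreal_leI)
    fix j :: nat and z assume j: "j \<in> {1..}" and z: "z \<in> S"
    have "real j powr s * (W z * x z ^ (j - 1)) =
        (real j powr s * x z ^ (j - 1) * (1 - x z) powr s) * (W z * (1 - x z) powr - s)"
      by (rule mult_cancel_unit(1)[OF powr_mult_powr_minus[OF x[OF z, THEN conjunct2]], symmetric])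
    also have "\<dots> \<le> (exp 1 * s powr s) * B"
      by (rule mult_mono) (use powr_power_upper[of "x z" s j] x[OF z] W[OF z] B s j z in auto)
    finally show "real j powr s * (W z * x z ^ (j - 1)) \<le> exp 1 * s powr s * B" .
  qed
  then show "?S < \<infinity>"
    by (rule le_less_trans) simp
qed

text \<open>The index that is optimal for \<open>z\<close> tends to infinity as \<open>x z\<close>
  tends to 1, so near 1 it falls into the range where the upper limit is already effective.\<close>

lemma limsup_powr_power_lower:
  fixes W x :: "'a \<Rightarrow> real"
  assumes s: "0 < s" and W: "\<And>z. z \<in> S \<Longrightarrow> 0 \<le> W z"
    and x: "\<And>z. z \<in> S \<Longrightarrow> 0 \<le> x z \<and> x z < 1"
    and lim: "limsup (\<lambda>j. SUP z\<in>S. ennreal (real j powr s * (W z * x z ^ (j - 1)))) < ennreal L"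
  shows "\<exists>\<delta><1. \<forall>z\<in>S. \<delta> < x z \<longrightarrow> W z * (1 - x z) powr - s \<le> exp 1 * 2 powr s * L"
proof -
  have "0 < ennreal L" using lim by (rule le_less_trans[rotated]) simp
  then have L: "0 < L" by simp
  from Limsup_lessD[OF lim] obtain J where
    J: "\<And>j. j \<ge> J \<Longrightarrow> (SUP z\<in>S. ennreal (real j powr s * (W z * x z ^ (j - 1)))) < ennreal L"
    unfolding eventually_sequentially by blast
  \<comment> \<open>The threshold says \<open>1 / (1 - x z) > J + 1\<close>, hence its integer part
    is at least \<open>J\<close>.\<close>
  have "W z * (1 - x z) powr - s \<le> exp 1 * 2 powr s * L"
    if z: "z \<in> S" and big: "1 - 1 / (real J + 1) < x z" for z
  proof -
    define j where "j = nat \<lfloor>1 / (1 - x z)\<rfloor>"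
    have "real J + 1 < 1 / (1 - x z)"
      using big x[OF z] by (simp add: field_simps)
    then have "J \<le> j" unfolding j_def by linarith
    have "ennreal (real j powr s * (W z * x z ^ (j - 1))) \<le>
        (SUP z\<in>S. ennreal (real j powr s * (W z * x z ^ (j - 1))))"
      using z by (intro SUP_upper) auto
    also have "\<dots> \<le> ennreal L" by (rule less_imp_le[OF J[OF \<open>J \<le> j\<close>]])
    finally have le: "real j powr s * (W z * x z ^ (j - 1)) \<le> L"
      using L by simp
    have "W z * (1 - x z) powr - s * 1 \<le> W z * (1 - x z) powr - s *
        (exp 1 * 2 powr s * (1 - x z) powr s * (real j powr s * x z ^ (j - 1)))"
      using x[OF z] W[OF z] s by (intro mult_left_mono powr_power_lower[OF _ _ _ j_def]) auto
    also have "\<dots> = exp 1 * 2 powr s * (real j powr s * (W z * x z ^ (j - 1)))"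
      by (rule mult_cancel_unit(2)[OF powr_mult_powr_minus[OF x[OF z, THEN conjunct2]]])
    also have "\<dots> \<le> exp 1 * 2 powr s * L"
      using le by (intro mult_left_mono) auto
    finally show ?thesis by simp
  qed
  then show ?thesis by (intro exI[of _ "1 - 1 / (real J + 1)"]) auto
qed

text \<open>\<open>powr_power_upper\<close> with exponent \<open>s + 1\<close> in place of
  \<open>s\<close> gains a factor \<open>1 / j\<close>.\<close>

lemma powr_power_tendsto_zero:
  fixes d s :: real
  assumes "0 \<le> d" "d < 1" "0 < s"
  shows "(\<lambda>j. real j powr s * d ^ (j - 1)) \<longlonglongrightarrow> 0"
proof -
  define t where "t = s + 1"
  define C where "C = exp 1 * t powr t * (1 - d) powr - t"
  have "\<bar>real j powr s * d ^ (j - 1)\<bar> \<le> C / real j" if "1 \<le> j" for j :: nat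
  proof -
    have "real j powr t * d ^ (j - 1) * (1 - d) powr t * (1 - d) powr - t \<le> C"
      unfolding C_def using powr_power_upper[of d t j] assms that
      by (intro mult_right_mono) (auto simp: t_def)
    then have "real j powr t * d ^ (j - 1) \<le> C"
      using powr_mult_powr_minus[of d t] assms by (simp add: mult.assoc)
    then show ?thesis
      using assms that by (simp add: t_def powr_add field_simps)
  qed
  then have "\<forall>\<^sub>F j in sequentially. norm (real j powr s * d ^ (j - 1)) \<le> C / real j"
    by (auto simp: eventually_sequentially intro!: exI[of _ 1])
  then show ?thesis
    by (rule Lim_null_comparison) (rule lim_const_over_n)
qed

text \<open>Points with \<open>x z\<close> above the threshold contribute at most the asserted bound
  for every \<open>j\<close>. At the others the powers decay geometrically and uniformly, because
  \<open>W\<close> is bounded, so they vanish in the limit.\<close>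

lemma limsup_powr_power_upper:
  fixes W x :: "'a \<Rightarrow> real"
  assumes s: "0 < s" and W: "\<And>z. z \<in> S \<Longrightarrow> 0 \<le> W z \<and> W z \<le> B"
    and x: "\<And>z. z \<in> S \<Longrightarrow> 0 \<le> x z \<and> x z < 1" and L: "0 \<le> L"
    and \<delta>: "\<delta> < 1" "\<And>z. z \<in> S \<Longrightarrow> \<delta> < x z \<Longrightarrow> W z * (1 - x z) powr - s \<le> L"
  shows "limsup (\<lambda>j. SUP z\<in>S. ennreal (real j powr s * (W z * x z ^ (j - 1)))) \<le>
    ennreal (exp 1 * s powr s * L)"
proof -
  \<comment> \<open>\<open>\<delta>\<close> may be negative, whereas \<open>d\<close> has to serve
    as the base of a power.\<close>
  define d where "d = max \<delta> 0"
  have d: "0 \<le> d" "d < 1" "\<delta> \<le> d" using \<delta> by (auto simp: d_def)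
  define b where "b = (\<lambda>j::nat. exp 1 * s powr s * L + \<bar>B\<bar> * (real j powr s * d ^ (j - 1)))"
  have le: "(SUP z\<in>S. ennreal (real j powr s * (W z * x z ^ (j - 1)))) \<le> ennreal (b j)"
    if j: "1 \<le> j" for j
  proof (intro SUP_least ennreal_leI)
    fix z assume z: "z \<in> S"
    show "real j powr s * (W z * x z ^ (j - 1)) \<le> b j"
    proof (cases "d < x z")
      case True
      have "real j powr s * (W z * x z ^ (j - 1)) =
          (real j powr s * x z ^ (j - 1) * (1 - x z) powr s) * (W z * (1 - x z) powr - s)"
        by (rule mult_cancel_unit(1)[OF powr_mult_powr_minus[OF x[OF z, THEN conjunct2]], symmetric])
      also have "\<dots> \<le> (exp 1 * s powr s) * L"
        by (rule mult_mono)
          (use powr_power_upper[of "x z" s j] x[OF z] W[OF z] \<delta>(2)[OF z] L s j True d in auto)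
      also have "\<dots> \<le> b j" using d by (simp add: b_def)
      finally show ?thesis .
    next
      case False
      have "W z * x z ^ (j - 1) \<le> \<bar>B\<bar> * d ^ (j - 1)"
        using False W[OF z] x[OF z] by (intro mult_mono power_mono) auto
      then have "real j powr s * (W z * x z ^ (j - 1)) \<le> real j powr s * (\<bar>B\<bar> * d ^ (j - 1))"
        by (intro mult_left_mono) auto
      also have "\<dots> \<le> b j" using L by (simp add: b_def mult_ac)
      finally show ?thesis .
    qed
  qed
  have "b \<longlonglongrightarrow> exp 1 * s powr s * L + \<bar>B\<bar> * 0"
    unfolding b_def by (intro tendsto_intros powr_power_tendsto_zero d s)
  then have "(\<lambda>j. ennreal (b j)) \<longlonglongrightarrow> ennreal (exp 1 * s powr s * L)"
    by (intro tendsto_ennrealI) simp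
  then have "limsup (\<lambda>j. ennreal (b j)) = ennreal (exp 1 * s powr s * L)"
    by (intro lim_imp_Limsup) auto
  moreover have "limsup (\<lambda>j. SUP z\<in>S. ennreal (real j powr s * (W z * x z ^ (j - 1)))) \<le>
      limsup (\<lambda>j. ennreal (b j))"
    using le by (intro Limsup_mono) (auto simp: eventually_sequentially)
  ultimately show ?thesis by simp
qed

section \<open>Poisson integrals and growth of Hardy functions\<close>

text \<open>This is Cauchy's formula at \<open>w\<close> for \<open>g\<close>, that is,
  \<open>f\<close> times a factor equal to 1 at \<open>w\<close>. On the circle,
  \<open>R\<^sup>2 = \<zeta> * cnj \<zeta>\<close> turns the denominator into
  \<open>\<zeta> * cnj (\<zeta> - w)\<close>, so the factor changes the Cauchy kernel into the
  Poisson kernel.\<close>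

lemma Poisson_integral_formula:
  fixes f :: "complex \<Rightarrow> complex"
  assumes cont: "continuous_on (cball 0 R) f" and hol: "f holomorphic_on ball 0 R"
    and w: "norm w < R"
  shows "((\<lambda>\<theta>. f (of_real R * cis \<theta>) *
      of_real ((R\<^sup>2 - (norm w)\<^sup>2) / (norm (of_real R * cis \<theta> - w))\<^sup>2))
    has_integral 2 * pi * f w) {0..2*pi}"
proof -
  define g where "g = (\<lambda>\<zeta>. f \<zeta> * of_real (R\<^sup>2 - (norm w)\<^sup>2) / (of_real (R\<^sup>2) - cnj w * \<zeta>))"
  have R: "0 < R" using w norm_ge_zero[of w] by linarith
  have nz: "of_real (R\<^sup>2) - cnj w * \<zeta> \<noteq> 0" if "\<zeta> \<in> cball 0 R" for \<zeta>
  proof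
    assume "of_real (R\<^sup>2) - cnj w * \<zeta> = 0"
    then have "norm (complex_of_real (R\<^sup>2)) = norm (cnj w * \<zeta>)" by simp
    then have "R * R = norm w * norm \<zeta>" by (simp add: norm_mult power2_eq_square abs_mult)
    also have "\<dots> \<le> norm w * R" using that by (intro mult_left_mono) auto
    finally show False using R w by simp
  qed
  have "((\<lambda>u. g u / (u - w)) has_contour_integral (2 * of_real pi * \<i> * g w)) (circlepath 0 R)"
  proof (rule Cauchy_integral_circlepath)
    show "continuous_on (cball 0 R) g"
      unfolding g_def by (intro continuous_intros cont) (use nz in auto)
    show "g holomorphic_on ball 0 R"
      unfolding g_def by (intro holomorphic_intros hol) (use nz in auto)
  qed (use w in simp)
  moreover have "complex_of_real (R\<^sup>2) - cnj w * w = of_real (R\<^sup>2 - (norm w)\<^sup>2)"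
    using complex_norm_square[of w] by (simp add: mult.commute)
  moreover have "R\<^sup>2 - (norm w)\<^sup>2 \<noteq> 0"
    using w R norm_ge_zero[of w] power_strict_mono[of "norm w" R 2] by simp
  ultimately have "((\<lambda>u. g u / (u - w)) has_contour_integral (2 * of_real pi * \<i> * f w))
      (part_circlepath 0 R 0 (2 * pi))"
    by (simp add: g_def circlepath_def del: of_real_power of_real_diff)
  then have "((\<lambda>\<theta>. g (0 + of_real R * cis \<theta>) / (0 + of_real R * cis \<theta> - w) * of_real R * \<i> * cis \<theta>)
      has_integral (2 * of_real pi * \<i> * f w)) {0..2 * pi}"
    using has_contour_integral_part_circlepath_iff[of 0 "2 * pi"] by fastforce
  \<comment> \<open>The factor \<open>R * \<i> * cis \<theta>\<close> is the derivative of the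
    parametrisation; multiplying by \<open>- \<i>\<close> removes its \<open>\<i>\<close> and that
    of \<open>2 * pi * \<i>\<close>.\<close>
  then have "((\<lambda>\<theta>. - \<i> * (g (0 + of_real R * cis \<theta>) / (0 + of_real R * cis \<theta> - w) * of_real R * \<i> * cis \<theta>))
      has_integral (- \<i> * (2 * of_real pi * \<i> * f w))) {0..2 * pi}"
    by (rule has_integral_mult_right)
  moreover have "- \<i> * (2 * of_real pi * \<i> * f w) = 2 * pi * f w"
    by (simp add: mult.assoc[symmetric])
  moreover have "- \<i> * (g (0 + of_real R * cis \<theta>) / (0 + of_real R * cis \<theta> - w) * of_real R * \<i> * cis \<theta>) =
      f (of_real R * cis \<theta>) * of_real ((R\<^sup>2 - (norm w)\<^sup>2) / (norm (of_real R * cis \<theta> - w))\<^sup>2)" for \<theta>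
  proof -
    define \<zeta> where "\<zeta> = of_real R * cis \<theta>"
    have nR: "norm \<zeta> = R" using R by (simp add: \<zeta>_def norm_mult)
    have ne: "\<zeta> \<noteq> w" "\<zeta> \<noteq> 0" using nR w R by auto
    have RR: "complex_of_real (R\<^sup>2) = \<zeta> * cnj \<zeta>"
      using nR complex_norm_square[of \<zeta>] by simp
    have "complex_of_real ((norm (\<zeta> - w))\<^sup>2) = (\<zeta> - w) * (cnj \<zeta> - cnj w)"
      using complex_norm_square[of "\<zeta> - w"] by simp
    moreover have "complex_of_real (R\<^sup>2) - cnj w * \<zeta> = \<zeta> * (cnj \<zeta> - cnj w)"
      unfolding RR by (simp add: algebra_simps)
    moreover have "cnj \<zeta> - cnj w \<noteq> 0" using ne by (metis complex_cnj_diff complex_cnj_zero_iff right_minus_eq)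
    ultimately have "g \<zeta> / (\<zeta> - w) * \<zeta> = f \<zeta> * of_real ((R\<^sup>2 - (norm w)\<^sup>2) / (norm (\<zeta> - w))\<^sup>2)"
      using ne by (simp add: g_def of_real_divide del: of_real_power of_real_diff)
    then show ?thesis by (simp add: \<zeta>_def[symmetric] mult_ac) (simp add: \<zeta>_def mult_ac)
  qed
  ultimately show ?thesis by (simp only:)
qed

lemma Poisson_kernel_has_integral:
  assumes "norm w < R"
  shows "((\<lambda>\<theta>. (R\<^sup>2 - (norm w)\<^sup>2) / (norm (of_real R * cis \<theta> - w))\<^sup>2) has_integral 2 * pi) {0..2*pi}"
  using has_integral_Re[OF Poisson_integral_formula[OF _ _ assms, of "\<lambda>_. 1"]] by simp

lemma continuous_on_circle:
  fixes f :: "complex \<Rightarrow> complex"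
  assumes "f holomorphic_on unit_disc" "0 \<le> r" "r < 1"
  shows "continuous_on A (\<lambda>\<theta>. f (of_real r * cis \<theta>))"
  by (rule continuous_on_compose2[OF holomorphic_on_imp_continuous_on[OF assms(1)]])
    (use assms in \<open>auto simp: norm_mult intro!: continuous_intros\<close>)

text \<open>For \<open>t > 0\<close> this is convexity of the power on the open half-line. The end
  point \<open>t = 0\<close> lies outside it; there the left side is
  \<open>(1 - p) * a powr p \<le> 0\<close>.\<close>

lemma powr_tangent_le:
  fixes a t p :: real
  assumes "1 \<le> p" "0 < a" "0 \<le> t"
  shows "a powr p + p * a powr (p - 1) * (t - a) \<le> t powr p"
proof (cases "t = 0")
  case True
  have "a powr p = a powr (p - 1) * a" using assms by (simp add: powr_diff)
  then have "a powr p + p * a powr (p - 1) * (t - a) = (1 - p) * a powr p"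
    using True by (simp add: algebra_simps)
  also have "\<dots> \<le> 0" using assms by (simp add: mult_nonpos_nonneg)
  finally show ?thesis using True by simp
next
  case False
  then have t: "0 < t" using assms by simp
  have "p * a powr (p - 1) * (t - a) \<le> t powr p - a powr p"
  proof (rule convex_on_imp_above_tangent[of "{0<..}"])
    show "((\<lambda>x. x powr p) has_real_derivative p * a powr (p - 1)) (at a within {0<..})"
      using assms by (intro DERIV_subset[OF has_real_derivative_powr]) auto
  qed (use assms t powr_convex in \<open>auto simp: interior_open\<close>)
  then show ?thesis by simp
qed

text \<open>Jensen's inequality for the Poisson kernel, via the tangent line of \<open>t powr p\<close> at \<open>norm (f w)\<close>.\<close>

lemma norm_powr_le_circle_mean:
  fixes f :: "complex \<Rightarrow> complex"
  assumes p: "1 \<le> p" and hol: "f holomorphic_on unit_disc" and w: "norm w < R" and R: "R < 1"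
  shows "norm (f w) powr p \<le>
    (R + norm w) / (R - norm w) * (1 / (2 * pi) * integral {0..2*pi} (\<lambda>\<theta>. norm (f (of_real R * cis \<theta>)) powr p))"
proof (cases "f w = 0")
  case True
  moreover have "0 \<le> R + norm w" using w norm_ge_zero[of w] by linarith
  ultimately show ?thesis
    using p w by (cases "(\<lambda>\<theta>. norm (f (of_real R * cis \<theta>)) powr p) integrable_on {0..2*pi}")
      (auto intro!: mult_nonneg_nonneg divide_nonneg_nonneg integral_nonneg simp: not_integrable_integral)
next
  case False
  define P where "P = (\<lambda>\<theta>. (R\<^sup>2 - (norm w)\<^sup>2) / (norm (of_real R * cis \<theta> - w))\<^sup>2)"
  define a where "a = norm (f w)"
  define F where "F = (\<lambda>\<theta>. f (of_real R * cis \<theta>))"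
  have a: "0 < a" using False by (simp add: a_def)
  have R0: "0 < R" using w norm_ge_zero[of w] by linarith
  have dist_ge: "R - norm w \<le> norm (of_real R * cis \<theta> - w)" for \<theta>
    using norm_triangle_ineq2[of "of_real R * cis \<theta>" w] R0 by (simp add: norm_mult)
  have num: "0 \<le> R\<^sup>2 - (norm w)\<^sup>2" using w R0 by (simp add: power_mono)
  have P0: "0 \<le> P \<theta>" for \<theta> using num by (simp add: P_def)
  have P1: "P \<theta> \<le> (R + norm w) / (R - norm w)" for \<theta>
  proof -
    have "P \<theta> \<le> (R\<^sup>2 - (norm w)\<^sup>2) / (R - norm w)\<^sup>2"
      unfolding P_def using dist_ge[of \<theta>] w num by (intro divide_left_mono power_mono mult_pos_pos zero_less_power) auto
    also have "\<dots> = (R + norm w) / (R - norm w)"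
      using w by (simp add: power2_eq_square square_diff_square_factored)
    finally show ?thesis .
  qed
  have contF: "continuous_on {0..2*pi} F"
    unfolding F_def using R0 R by (intro continuous_on_circle[OF hol]) auto
  have contP: "continuous_on {0..2*pi} P"
  proof -
    have "norm (of_real R * cis \<theta> - w) \<noteq> 0" for \<theta> using dist_ge[of \<theta>] w by linarith
    then show ?thesis unfolding P_def by (intro continuous_intros) auto
  qed
  have intF: "((\<lambda>\<theta>. F \<theta> * of_real (P \<theta>)) has_integral 2 * pi * f w) {0..2*pi}"
    unfolding F_def P_def
    using R w by (intro Poisson_integral_formula holomorphic_on_imp_continuous_on holomorphic_on_subset[OF hol]) auto
  have intP: "(P has_integral 2 * pi) {0..2*pi}"
    unfolding P_def by (rule Poisson_kernel_has_integral[OF w])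
  have int1: "(\<lambda>\<theta>. norm (F \<theta>) * P \<theta>) integrable_on {0..2*pi}"
    by (intro integrable_continuous_interval continuous_intros contF contP)
  have int2: "(\<lambda>\<theta>. norm (F \<theta>) powr p) integrable_on {0..2*pi}"
    using p by (intro integrable_continuous_interval continuous_on_powr' continuous_intros contF) auto
  have "norm (integral {0..2*pi} (\<lambda>\<theta>. F \<theta> * of_real (P \<theta>))) \<le>
      integral {0..2*pi} (\<lambda>\<theta>. norm (F \<theta>) * P \<theta>)"
    using P0 by (intro integral_norm_bound_integral has_integral_integrable[OF intF] int1)
      (simp add: norm_mult)
  then have "norm (2 * pi * f w) \<le> integral {0..2*pi} (\<lambda>\<theta>. norm (F \<theta>) * P \<theta>)"
    by (simp only: integral_unique[OF intF])
  then have mean: "2 * pi * a \<le> integral {0..2*pi} (\<lambda>\<theta>. norm (F \<theta>) * P \<theta>)"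
    by (simp add: norm_mult a_def)
  \<comment> \<open>The tangent inequality at \<open>t = norm (F \<theta>)\<close>, multiplied by
    \<open>P\<close>, is integrated. The mass \<open>2 * pi\<close> of \<open>P\<close> and
    \<open>mean\<close> bound the left side from below by \<open>2 * pi * a powr p\<close>; the
    maximum of \<open>P\<close> is inserted only on the right.\<close>
  have "((\<lambda>\<theta>. (1 - p) * a powr p * P \<theta> + p * a powr (p - 1) * (norm (F \<theta>) * P \<theta>)) has_integral
     ((1 - p) * a powr p * (2 * pi) + p * a powr (p - 1) * integral {0..2*pi} (\<lambda>\<theta>. norm (F \<theta>) * P \<theta>))) {0..2*pi}"
    by (intro has_integral_add has_integral_mult_right intP integrable_integral int1)
  moreover have "((\<lambda>\<theta>. (R + norm w) / (R - norm w) * (norm (F \<theta>) powr p)) has_integral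
     ((R + norm w) / (R - norm w) * integral {0..2*pi} (\<lambda>\<theta>. norm (F \<theta>) powr p))) {0..2*pi}"
    by (intro has_integral_mult_right integrable_integral int2)
  moreover have "(1 - p) * a powr p * P \<theta> + p * a powr (p - 1) * (norm (F \<theta>) * P \<theta>) \<le>
      (R + norm w) / (R - norm w) * (norm (F \<theta>) powr p)" for \<theta>
  proof -
    have ap: "a powr p = a powr (p - 1) * a" using a by (simp add: powr_diff)
    have "(1 - p) * a powr p * P \<theta> + p * a powr (p - 1) * (norm (F \<theta>) * P \<theta>) =
       (a powr p + p * a powr (p - 1) * (norm (F \<theta>) - a)) * P \<theta>"
      by (simp add: ap algebra_simps)
    also have "\<dots> \<le> norm (F \<theta>) powr p * P \<theta>"
      using powr_tangent_le[OF p a, of "norm (F \<theta>)"] P0 by (intro mult_right_mono) auto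
    also have "\<dots> \<le> norm (F \<theta>) powr p * ((R + norm w) / (R - norm w))"
      using P1 by (intro mult_left_mono) auto
    finally show ?thesis by (simp add: mult.commute)
  qed
  ultimately have "(1 - p) * a powr p * (2 * pi) + p * a powr (p - 1) * integral {0..2*pi} (\<lambda>\<theta>. norm (F \<theta>) * P \<theta>)
     \<le> (R + norm w) / (R - norm w) * integral {0..2*pi} (\<lambda>\<theta>. norm (F \<theta>) powr p)"
    by (rule has_integral_le)
  moreover have "p * a powr (p - 1) * (2 * pi * a) \<le> p * a powr (p - 1) * integral {0..2*pi} (\<lambda>\<theta>. norm (F \<theta>) * P \<theta>)"
    using mean p by (intro mult_left_mono) auto
  moreover have "p * a powr (p - 1) * (2 * pi * a) = p * a powr p * (2 * pi)"
    using a by (simp add: powr_diff)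
  moreover have "(1 - p) * a powr p * (2 * pi) = a powr p * (2 * pi) - p * a powr p * (2 * pi)"
    by (simp only: left_diff_distrib mult_1_left)
  ultimately have "a powr p * (2 * pi) \<le>
      (R + norm w) / (R - norm w) * integral {0..2*pi} (\<lambda>\<theta>. norm (F \<theta>) powr p)"
    by linarith
  then have "a powr p \<le> ((R + norm w) / (R - norm w) * integral {0..2*pi} (\<lambda>\<theta>. norm (F \<theta>) powr p)) / (2 * pi)"
    by (subst pos_le_divide_eq) auto
  then show ?thesis by (simp add: a_def F_def)
qed

section \<open>Integral means versus the norm, and growth classes of functions on the disc\<close>

lemma hardy_norm_leD:
  assumes p: "1 \<le> p" and le: "hardy_norm p f \<le> ennreal c" and c: "0 \<le> c" and r: "0 < r" "r < 1"
  shows "1 / (2 * pi) * integral {0..2*pi} (\<lambda>\<theta>. norm (f (of_real r * cis \<theta>)) powr p) \<le> c powr p"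
    (is "?m \<le> _")
proof -
  have fin: "hardy_norm_pow p f \<noteq> \<infinity>"
    using le by (auto simp: hardy_norm_def top_unique split: if_splits)
  define P where "P = enn2real (hardy_norm_pow p f)"
  have P: "0 \<le> P" "hardy_norm_pow p f = ennreal P"
    using fin by (auto simp: P_def top.not_eq_extremum)
  have "P powr (1 / p) \<le> c"
    using le fin c by (simp add: hardy_norm_def P_def)
  then have "(P powr (1 / p)) powr p \<le> c powr p"
    using p by (intro powr_mono2) auto
  then have Pc: "P \<le> c powr p"
    using p P by (simp add: powr_powr)
  have "ennreal ?m \<le> hardy_norm_pow p f"
    unfolding hardy_norm_pow_def using r by (intro SUP_upper) auto
  then have "?m \<le> P" using P by simp
  then show ?thesis using Pc by simp
qed

lemma hardy_norm_leI:
  assumes p: "1 \<le> p" and c: "0 \<le> c"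
    and le: "\<And>r. 0 < r \<Longrightarrow> r < 1 \<Longrightarrow>
      1 / (2 * pi) * integral {0..2*pi} (\<lambda>\<theta>. norm (f (of_real r * cis \<theta>)) powr p) \<le> c powr p"
  shows "hardy_norm p f \<le> ennreal c"
proof -
  have pow: "hardy_norm_pow p f \<le> ennreal (c powr p)"
    unfolding hardy_norm_pow_def using le by (intro SUP_least ennreal_leI) auto
  then have fin: "hardy_norm_pow p f \<noteq> \<infinity>" by (auto simp: top_unique)
  have "enn2real (hardy_norm_pow p f) \<le> c powr p"
    using pow by (intro enn2real_leI) auto
  then have "enn2real (hardy_norm_pow p f) powr (1 / p) \<le> (c powr p) powr (1 / p)"
    using p by (intro powr_mono2) auto
  also have "\<dots> = c" using p c by (simp add: powr_powr)
  finally show ?thesis using fin by (simp add: hardy_norm_def ennreal_leI)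
qed

text \<open>These are exactly the bounds on \<open>f\<close> and its derivative that the derivative
  of \<open>u * f(\<phi>)\<close> needs, with \<open>s = 1 / p\<close>. Upper estimates are made for
  this class instead of the Hardy space, since differences, dilations and locally uniform limits are
  easily controlled in it.\<close>

definition growth :: "real \<Rightarrow> real \<Rightarrow> (complex \<Rightarrow> complex) \<Rightarrow> bool" where
  "growth s c f \<longleftrightarrow> f holomorphic_on unit_disc \<and>
    (\<forall>w\<in>unit_disc. norm (f w) \<le> c * (1 - norm w) powr - s \<and>
      norm (deriv f w) \<le> c * (1 - norm w) powr - (1 + s))"

text \<open>Cauchy's inequality on the circle of radius \<open>(1 - \<delta>) / 2\<close> about
  \<open>w\<close>, which stays where the bound \<open>B\<close> holds.\<close>

lemma norm_deriv_le_of_bound: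
  assumes hol: "f holomorphic_on unit_disc" and w: "norm w \<le> \<delta>" and \<delta>: "\<delta> < 1"
    and B: "\<And>v. norm v \<le> (1 + \<delta>) / 2 \<Longrightarrow> norm (f v) \<le> B"
  shows "norm (deriv f w) \<le> 2 * B / (1 - \<delta>)"
proof -
  have sub: "cball w ((1 - \<delta>) / 2) \<subseteq> cball 0 ((1 + \<delta>) / 2)"
    using w by (subst cball_subset_cball_iff) (auto simp: field_simps)
  also have sub': "\<dots> \<subseteq> unit_disc" using \<delta> by (auto simp: field_simps)
  finally have hol': "f holomorphic_on cball w ((1 - \<delta>) / 2)"
    using hol holomorphic_on_subset by blast
  have "norm ((deriv ^^ 1) f w) \<le> fact 1 * B / ((1 - \<delta>) / 2) ^ 1"
  proof (rule Cauchy_inequality)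
    show "norm (f x) \<le> B" if "norm (w - x) = (1 - \<delta>) / 2" for x
      using that sub by (intro B) (auto simp: dist_norm subset_iff)
  qed (use \<delta> hol' holomorphic_on_imp_continuous_on holomorphic_on_subset ball_subset_cball in \<open>auto\<close>)
  then show ?thesis by (simp add: mult.commute)
qed

text \<open>The derivative bound follows from the size bound by Cauchy's inequality at half the
  distance to the boundary. The cost is \<open>2 * 2 powr s\<close>, at most 4 because
  \<open>s \<le> 1\<close>.\<close>

lemma growthI:
  assumes hol: "f holomorphic_on unit_disc" and s: "0 \<le> s" "s \<le> 1" and a: "0 \<le> a"
    and le: "\<And>w. w \<in> unit_disc \<Longrightarrow> norm (f w) \<le> a * (1 - norm w) powr - s"
  shows "growth s (4 * a) f"
  unfolding growth_def
proof (intro conjI ballI hol)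
  fix w assume w: "w \<in> unit_disc"
  define y where "y = 1 - norm w"
  have y: "0 < y" using w by (simp add: y_def)
  have "a * y powr - s \<le> 4 * a * y powr - s" using a by (simp add: mult_right_mono)
  then show "norm (f w) \<le> 4 * a * (1 - norm w) powr - s"
    using le[OF w] by (simp add: y_def)
  have "norm (deriv f w) \<le> 2 * (a * (y / 2) powr - s) / (1 - norm w)"
  proof (rule norm_deriv_le_of_bound[OF hol order_refl])
    fix v :: complex assume v: "norm v \<le> (1 + norm w) / 2"
    have "v \<in> unit_disc" using v w by simp
    then have "norm (f v) \<le> a * (1 - norm v) powr - s" by (rule le)
    also have "\<dots> \<le> a * (y / 2) powr - s"
      using a s v y by (intro mult_left_mono powr_mono2') (auto simp: y_def field_simps)
    finally show "norm (f v) \<le> a * (y / 2) powr - s" .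
  qed (use w in auto)
  also have "\<dots> = 2 * 2 powr s * a * y powr - (1 + s)"
  proof -
    have "(y / 2) powr - s = 2 powr s * y powr - s"
      using y by (simp add: powr_divide powr_minus field_simps)
    moreover have "y powr - (1 + s) = y powr - s / y"
      using powr_add[of y "- 1" "- s"] y by (simp add: powr_minus_divide)
    ultimately show ?thesis by (simp add: y_def)
  qed
  also have "\<dots> \<le> 2 * 2 powr 1 * a * y powr - (1 + s)"
    using s a by (intro mult_right_mono mult_left_mono powr_mono) auto
  finally show "norm (deriv f w) \<le> 4 * a * (1 - norm w) powr - (1 + s)"
    by (simp add: y_def)
qed

lemma growth_diff:
  assumes "growth s a f" "growth s b g"
  shows "growth s (a + b) (\<lambda>w. f w - g w)"
  unfolding growth_def
proof (intro conjI ballI)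
  show "(\<lambda>w. f w - g w) holomorphic_on unit_disc"
    using assms by (auto simp: growth_def intro: holomorphic_intros)
  fix w assume w: "w \<in> unit_disc"
  have d: "f field_differentiable at w" "g field_differentiable at w"
    using assms w by (auto simp: growth_def intro: holomorphic_on_imp_differentiable_at[of _ unit_disc])
  show "norm (f w - g w) \<le> (a + b) * (1 - norm w) powr - s"
    using assms w norm_triangle_ineq4[of "f w" "g w"] unfolding growth_def distrib_right by fastforce
  show "norm (deriv (\<lambda>w. f w - g w) w) \<le> (a + b) * (1 - norm w) powr - (1 + s)"
    using assms w norm_triangle_ineq4[of "deriv f w" "deriv g w"] d
    unfolding growth_def distrib_right by (simp only: deriv_diff) fastforce
qed

lemma mult_in_unit_disc:
  assumes "0 \<le> r" "r \<le> 1" "w \<in> unit_disc"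
  shows "of_real r * w \<in> unit_disc"
  using assms mult_left_le_one_le[of "norm w" r] by (auto simp: norm_mult)

lemma deriv_dilate:
  assumes "f holomorphic_on unit_disc" "0 \<le> r" "r \<le> 1" "w \<in> unit_disc"
  shows "deriv (\<lambda>w. f (of_real r * w)) w = of_real r * deriv f (of_real r * w)"
proof -
  have "(f has_field_derivative deriv f (of_real r * w)) (at (of_real r * w))"
    using assms mult_in_unit_disc[OF assms(2-)] by (intro holomorphic_derivI) auto
  then have "((\<lambda>w. f (of_real r * w)) has_field_derivative deriv f (of_real r * w) * of_real r) (at w)"
    by (rule DERIV_chain2) (auto intro!: derivative_eq_intros)
  then show ?thesis by (simp add: DERIV_imp_deriv mult.commute)
qed

lemma holomorphic_on_dilate:
  assumes "f holomorphic_on unit_disc" "0 \<le> r" "r \<le> 1"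
  shows "(\<lambda>w. f (of_real r * w)) holomorphic_on unit_disc"
  by (rule holomorphic_on_compose_gen[of "\<lambda>w. of_real r * w" _ f unit_disc, unfolded o_def])
    (use assms mult_in_unit_disc in \<open>auto intro!: holomorphic_intros\<close>)

lemma growth_dilate:
  assumes f: "growth s c f" and r: "0 \<le> r" "r \<le> 1" and s: "0 \<le> s"
  shows "growth s c (\<lambda>w. f (of_real r * w))"
  unfolding growth_def
proof (intro conjI ballI)
  have hol: "f holomorphic_on unit_disc" using f by (simp add: growth_def)
  then show "(\<lambda>w. f (of_real r * w)) holomorphic_on unit_disc"
    using r by (rule holomorphic_on_dilate)
  fix w assume w: "w \<in> unit_disc"
  have rw: "of_real r * w \<in> unit_disc" by (rule mult_in_unit_disc[OF r w])
  \<comment> \<open>The sign of \<open>c\<close> is not assumed; it follows from the size bound at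
    the origin.\<close>
  have "0 \<le> norm (f 0)" by simp
  also have "\<dots> \<le> c * (1 - norm (0::complex)) powr - s"
    using f unfolding growth_def by (metis centre_in_ball zero_less_one)
  finally have c: "0 \<le> c" by simp
  have y: "0 < 1 - norm w" "1 - norm w \<le> 1 - norm (of_real r * w)"
    using w r by (auto simp: norm_mult mult_left_le_one_le)
  have "norm (f (of_real r * w)) \<le> c * (1 - norm (of_real r * w)) powr - s"
    using f rw by (simp add: growth_def)
  also have "\<dots> \<le> c * (1 - norm w) powr - s"
    using y s c by (intro mult_left_mono powr_mono2') auto
  finally show "norm (f (of_real r * w)) \<le> c * (1 - norm w) powr - s" .
  have "norm (deriv (\<lambda>w. f (of_real r * w)) w) \<le> 1 * norm (deriv f (of_real r * w))"
    unfolding deriv_dilate[OF hol r w] norm_mult using r by (intro mult_right_mono) auto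
  also have "\<dots> \<le> c * (1 - norm (of_real r * w)) powr - (1 + s)"
    using f rw by (simp add: growth_def)
  also have "\<dots> \<le> c * (1 - norm w) powr - (1 + s)"
    using y s c by (intro mult_left_mono powr_mono2') auto
  finally show "norm (deriv (\<lambda>w. f (of_real r * w)) w) \<le> c * (1 - norm w) powr - (1 + s)" .
qed

text \<open>Mean value inequality on \<open>cball 0 d\<close>. The bound involves \<open>f\<close>
  only through \<open>c\<close>, so one \<open>r\<close> close to 1 serves a whole growth class at
  once.\<close>

lemma dilate_diff_le:
  assumes f: "growth s c f" and r: "0 \<le> r" "r \<le> 1" and s: "0 \<le> s" and c: "0 \<le> c"
    and w: "norm w \<le> d" and d: "d < 1"
  shows "norm (f w - f (of_real r * w)) \<le> c * (1 - d) powr - (1 + s) * (1 - r)"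
proof -
  have hol: "f holomorphic_on unit_disc" using f by (simp add: growth_def)
  have d0: "0 \<le> d" using w norm_ge_zero[of w] by linarith
  have "norm (f w - f (of_real r * w)) \<le> c * (1 - d) powr - (1 + s) * norm (w - of_real r * w)"
  proof (rule field_differentiable_bound[of "cball 0 d" f "deriv f"])
    fix z assume z: "z \<in> cball (0::complex) d"
    then have zd: "z \<in> unit_disc" using d by auto
    show "(f has_field_derivative deriv f z) (at z within cball 0 d)"
      using holomorphic_derivI[OF hol _ zd] by auto
    have "norm (deriv f z) \<le> c * (1 - norm z) powr - (1 + s)"
      using f zd by (simp add: growth_def)
    also have "\<dots> \<le> c * (1 - d) powr - (1 + s)"
      using z d s c by (intro mult_left_mono powr_mono2') auto
    finally show "norm (deriv f z) \<le> c * (1 - d) powr - (1 + s)" .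
  next
    have "norm (of_real r * w) \<le> norm w"
      using r by (simp add: norm_mult mult_left_le_one_le)
    then show "of_real r * w \<in> cball 0 d" using w by simp
  qed (use w in auto)
  also have "norm (w - of_real r * w) = (1 - r) * norm w"
  proof -
    have "w - of_real r * w = of_real (1 - r) * w" by (simp add: algebra_simps)
    then show ?thesis using r by (simp only: norm_mult norm_of_real abs_of_nonneg diff_ge_0_iff_ge)
  qed
  also have "c * (1 - d) powr - (1 + s) * ((1 - r) * norm w) \<le> c * (1 - d) powr - (1 + s) * ((1 - r) * 1)"
    using r w d c by (intro mult_left_mono) auto
  finally show ?thesis by simp
qed

lemma hardy_growth:
  assumes p: "1 \<le> p" and f: "f \<in> fspace (hardy_norm p)" and c: "0 \<le> c"
    and le: "hardy_norm p f \<le> ennreal c"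
  shows "growth (1 / p) (16 * c) f"
proof -
  have hol: "f holomorphic_on unit_disc" using f by (simp add: fspace_def)
  have "growth (1 / p) (4 * (4 * c)) f"
  proof (rule growthI[OF hol])
    fix w assume w: "w \<in> unit_disc"
    \<comment> \<open>The circle halfway to the boundary gives
      \<open>(R + norm w) / (R - norm w) \<le> 4 / y\<close>. The \<open>p\<close>-th root costs
      \<open>4 powr (1 / p) \<le> 4\<close>, and \<open>growthI\<close> another 4: this is the
      constant 16.\<close>
    define R where "R = (1 + norm w) / 2"
    define y where "y = 1 - norm w"
    have y: "0 < y" using w by (simp add: y_def)
    have R: "norm w < R" "R < 1" "0 < R" using w by (auto simp: R_def add_pos_nonneg)
    have "norm (f w) powr p \<le> (R + norm w) / (R - norm w) *
        (1 / (2 * pi) * integral {0..2*pi} (\<lambda>\<theta>. norm (f (of_real R * cis \<theta>)) powr p))"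
      using R by (intro norm_powr_le_circle_mean p hol) auto
    also have "\<dots> \<le> (R + norm w) / (R - norm w) * c powr p"
      using R by (intro mult_left_mono hardy_norm_leD[OF p le c] divide_nonneg_pos) (auto intro: add_nonneg_nonneg less_imp_le)
    also have "\<dots> \<le> (4 / y) * c powr p"
    proof (rule mult_right_mono)
      have "(R + norm w) / (R - norm w) \<le> 2 / (y / 2)"
        using w y by (intro frac_le) (auto simp: R_def y_def field_simps)
      then show "(R + norm w) / (R - norm w) \<le> 4 / y" by simp
    qed simp
    finally have "(norm (f w) powr p) powr (1 / p) \<le> ((4 / y) * c powr p) powr (1 / p)"
      using p by (intro powr_mono2) auto
    then have "norm (f w) \<le> 4 powr (1 / p) * c * y powr - (1 / p)"
      using p y c by (simp add: powr_powr powr_mult powr_divide powr_minus field_simps)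
    also have "\<dots> \<le> 4 powr 1 * c * y powr - (1 / p)"
      using p c by (intro mult_right_mono powr_mono) auto
    finally show "norm (f w) \<le> 4 * c * (1 - norm w) powr - (1 / p)" by (simp add: y_def)
  qed (use p c in auto)
  then show ?thesis by simp
qed

section \<open>Test functions\<close>

lemma norm_one_minus_cnj_mult_ge:
  assumes "norm w \<le> 1"
  shows "1 - norm a \<le> norm (1 - cnj a * w)"
proof -
  have "norm (cnj a * w) \<le> norm a * 1"
    unfolding norm_mult complex_mod_cnj using assms by (intro mult_left_mono) auto
  then show ?thesis using norm_triangle_ineq2[of 1 "cnj a * w"] by simp
qed

text \<open>On the circle of radius \<open>r\<close> the integrand is, up to normalisation, the
  Poisson kernel of the unit circle at the point \<open>r * a\<close>.\<close>

lemma kernel_mean_le: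
  assumes a: "a \<in> unit_disc" and r: "0 < r" "r < 1"
  shows "((\<lambda>\<theta>. (1 - (norm a)\<^sup>2) / (norm (1 - cnj a * (of_real r * cis \<theta>)))\<^sup>2) has_integral
     2 * pi * ((1 - (norm a)\<^sup>2) / (1 - (r * norm a)\<^sup>2))) {0..2*pi}"
    and "(1 - (norm a)\<^sup>2) / (1 - (r * norm a)\<^sup>2) \<le> 1"
proof -
  have ra: "r * norm a < 1" "r * norm a \<le> norm a"
    using a r mult_strict_mono[of r 1 "norm a" 1] by (auto simp: mult_left_le_one_le)
  have nra: "norm (of_real r * a) = r * norm a" using r by (simp add: norm_mult)
  have sq: "(r * norm a)\<^sup>2 < 1" using ra r by (simp add: abs_square_less_1 abs_mult)
  \<comment> \<open>Conjugation and multiplication by the unimodular \<open>cis \<theta>\<close>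
    both preserve the norm.\<close>
  have eq: "norm (of_real 1 * cis \<theta> - of_real r * a) = norm (1 - cnj a * (of_real r * cis \<theta>))" for \<theta>
  proof -
    have "norm (cis \<theta> - of_real r * a) = norm (cnj (cis \<theta> - of_real r * a))"
      by (simp only: complex_mod_cnj)
    also have "\<dots> = norm (cis \<theta> * cnj (cis \<theta> - of_real r * a))"
      by (simp add: norm_mult)
    also have "cis \<theta> * cnj (cis \<theta> - of_real r * a) = 1 - cnj a * (of_real r * cis \<theta>)"
      by (simp add: algebra_simps cis_cnj cis_mult)
    finally show ?thesis by simp
  qed
  have "((\<lambda>\<theta>. (1\<^sup>2 - (norm (of_real r * a))\<^sup>2) / (norm (of_real 1 * cis \<theta> - of_real r * a))\<^sup>2)
      has_integral 2 * pi) {0..2*pi}"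
    by (rule Poisson_kernel_has_integral) (use ra nra in simp)
  then have "((\<lambda>\<theta>. (1 - (norm a)\<^sup>2) / (1 - (r * norm a)\<^sup>2) * ((1 - (r * norm a)\<^sup>2) /
      (norm (1 - cnj a * (of_real r * cis \<theta>)))\<^sup>2)) has_integral
     (1 - (norm a)\<^sup>2) / (1 - (r * norm a)\<^sup>2) * (2 * pi)) {0..2*pi}"
    unfolding eq nra power_one by (rule has_integral_mult_right)
  then show "((\<lambda>\<theta>. (1 - (norm a)\<^sup>2) / (norm (1 - cnj a * (of_real r * cis \<theta>)))\<^sup>2) has_integral
     2 * pi * ((1 - (norm a)\<^sup>2) / (1 - (r * norm a)\<^sup>2))) {0..2*pi}"
    using sq by (simp add: mult.commute)
  have "(r * norm a)\<^sup>2 \<le> (norm a)\<^sup>2"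
    using ra r by (intro power_mono) auto
  then show "(1 - (norm a)\<^sup>2) / (1 - (r * norm a)\<^sup>2) \<le> 1"
    using sq by (simp add: divide_le_eq)
qed

text \<open>With \<open>q = 1 - (norm a)\<^sup>2\<close> and \<open>N = norm (1 - cnj a * w) \<ge> q / 2\<close>, the \<open>p\<close>-th power of the
  bound is \<open>c powr p * (q / N) powr (2 * p - 2) * (q / N\<^sup>2)\<close>; the middle factor is bounded, and the
  last one is dominated on circles by the Poisson kernel.\<close>

lemma hardy_norm_le_kernel:
  assumes p: "1 \<le> p" and a: "a \<in> unit_disc" and c: "0 \<le> c" and hol: "f holomorphic_on unit_disc"
    and le: "\<And>w. w \<in> unit_disc \<Longrightarrow>
      norm (f w) \<le> c * (1 - (norm a)\<^sup>2) powr (2 - 1 / p) / (norm (1 - cnj a * w))\<^sup>2"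
  shows "hardy_norm p f \<le> ennreal (4 * c)"
proof (rule hardy_norm_leI[OF p])
  fix r :: real assume r: "0 < r" "r < 1"
  define q where "q = 1 - (norm a)\<^sup>2"
  define N where "N = (\<lambda>\<theta>. norm (1 - cnj a * (of_real r * cis \<theta>)))"
  have q: "0 < q" using a by (simp add: q_def power_less_one_iff abs_square_less_1)
  have qN: "q \<le> 2 * N \<theta>" for \<theta>
  proof -
    have "q = (1 - norm a) * (1 + norm a)" by (simp add: q_def power2_eq_square algebra_simps)
    also have "\<dots> \<le> (1 - norm a) * 2" using a by (intro mult_left_mono) auto
    also have "1 - norm a \<le> N \<theta>"
      unfolding N_def using r by (intro norm_one_minus_cnj_mult_ge) (simp add: norm_mult)
    finally show ?thesis by simp
  qed
  have N: "0 < N \<theta>" for \<theta> using qN[of \<theta>] q by linarith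
  have pw: "norm (f (of_real r * cis \<theta>)) powr p \<le> (4 * c) powr p * (q / (N \<theta>)\<^sup>2)" for \<theta>
  proof -
    have "norm (f (of_real r * cis \<theta>)) \<le> c * q powr (2 - 1 / p) / (N \<theta>)\<^sup>2"
      unfolding q_def N_def using r by (intro le) (simp add: norm_mult)
    then have "norm (f (of_real r * cis \<theta>)) powr p \<le> (c * q powr (2 - 1 / p) / (N \<theta>)\<^sup>2) powr p"
      using p by (intro powr_mono2) auto
    also have "\<dots> = c powr p * q powr ((2 - 1 / p) * p) / N \<theta> powr (2 * p)"
      using c N[of \<theta>] q powr_powr[of "N \<theta>" 2 p] by (simp add: powr_divide powr_mult powr_powr)
    \<comment> \<open>The exponent \<open>2 - 1 / p\<close> was chosen for this: exactly one power
      of \<open>q\<close> is left over to normalise the Poisson kernel.\<close>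
    also have "(2 - 1 / p) * p = (2 * p - 2) + 1" using p by (simp add: field_simps)
    also have "c powr p * q powr ((2 * p - 2) + 1) / N \<theta> powr (2 * p) =
        c powr p * ((q / N \<theta>) powr (2 * p - 2) * (q / (N \<theta>)\<^sup>2))"
    proof -
      have "N \<theta> powr (2 * p) = N \<theta> powr (2 * p - 2) * (N \<theta>)\<^sup>2"
        using N[of \<theta>] by (simp add: powr_diff powr_realpow)
      moreover have "q powr ((2 * p - 2) + 1) = q powr (2 * p - 2) * q"
        unfolding powr_add using q by simp
      ultimately show ?thesis using N[of \<theta>] q by (simp only: powr_divide) (simp add: powr_divide)
    qed
    \<comment> \<open>Here \<open>q / N \<le> 2\<close> is raised to
      \<open>2 * p - 2 \<ge> 0\<close>. Rounding the exponent up to \<open>2 * p\<close> yields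
      \<open>4 powr p\<close>, which merges with \<open>c powr p\<close>.\<close>
    also have "\<dots> \<le> c powr p * (2 powr (2 * p) * (q / (N \<theta>)\<^sup>2))"
    proof (intro mult_left_mono mult_right_mono)
      have "(q / N \<theta>) powr (2 * p - 2) \<le> 2 powr (2 * p - 2)"
        using p q qN[of \<theta>] N[of \<theta>] by (intro powr_mono2) (auto simp: divide_le_eq)
      also have "\<dots> \<le> 2 powr (2 * p)" by (rule powr_mono) auto
      finally show "(q / N \<theta>) powr (2 * p - 2) \<le> 2 powr (2 * p)" .
    qed (use q in auto)
    also have "2 powr (2 * p) = 4 powr p"
      using powr_powr[of 2 2 p] by simp
    finally show ?thesis using c by (simp add: powr_mult mult_ac)
  qed
  have int: "((\<lambda>\<theta>. (4 * c) powr p * (q / (N \<theta>)\<^sup>2)) has_integral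
      (4 * c) powr p * (2 * pi * (q / (1 - (r * norm a)\<^sup>2)))) {0..2*pi}"
    unfolding q_def N_def by (intro has_integral_mult_right kernel_mean_le a r)
  have "integral {0..2*pi} (\<lambda>\<theta>. norm (f (of_real r * cis \<theta>)) powr p) \<le>
      integral {0..2*pi} (\<lambda>\<theta>. (4 * c) powr p * (q / (N \<theta>)\<^sup>2))"
  proof (rule integral_le)
    show "(\<lambda>\<theta>. norm (f (of_real r * cis \<theta>)) powr p) integrable_on {0..2*pi}"
      using p r by (intro integrable_continuous_interval continuous_on_powr' continuous_intros
          continuous_on_circle[OF hol]) auto
  qed (use has_integral_integrable[OF int] pw in auto)
  also have "\<dots> = (4 * c) powr p * (2 * pi * (q / (1 - (r * norm a)\<^sup>2)))"
    using int by (rule integral_unique)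
  also have "\<dots> \<le> (4 * c) powr p * (2 * pi * 1)"
    using kernel_mean_le(2)[OF a r] unfolding q_def by (intro mult_left_mono) auto
  finally show "1 / (2 * pi) * integral {0..2*pi} (\<lambda>\<theta>. norm (f (of_real r * cis \<theta>)) powr p) \<le> (4 * c) powr p"
    by (simp add: divide_le_eq mult.commute)
qed (use c in auto)

text \<open>Compactness of the closed disc. Boundedness of each single test function and of its
  derivative makes it negligible near the boundary in \<open>test_le_op_norm_diff\<close>.\<close>

lemma holomorphic_bounded_with_deriv:
  assumes "f holomorphic_on S" "open S" "cball 0 1 \<subseteq> S"
  shows "\<exists>B. \<forall>w\<in>unit_disc. norm (f w) \<le> B \<and> norm (deriv f w) \<le> B"
proof -
  have "bounded (f ` cball 0 1)" "bounded (deriv f ` cball 0 1)"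
    using assms
    by (auto intro!: compact_imp_bounded compact_continuous_image holomorphic_on_imp_continuous_on
        intro: holomorphic_on_subset holomorphic_deriv)
  then obtain A B where "\<forall>w\<in>cball 0 1. norm (f w) \<le> A" "\<forall>w\<in>cball 0 1. norm (deriv f w) \<le> B"
    by (auto simp: bounded_iff simp del: mem_cball_0)
  then show ?thesis by (intro exI[of _ "max A B"]) (auto simp: le_max_iff_disj)
qed

text \<open>Both test functions come from \<open>F w = q powr (2 - 1 / p) / (1 - cnj a * w)\<^sup>2\<close> with
  \<open>q = 1 - (norm a)\<^sup>2\<close> and the involution \<open>M w = (a - w) / (1 - cnj a * w)\<close>: \<open>F * M\<close> vanishes at
  \<open>a\<close>, and the derivative of \<open>F * (1 + 2 * cnj a * M)\<close> does.\<close>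

lemma hardy_test_functions:
  assumes p: "1 \<le> p" and a: "a \<in> unit_disc"
  obtains h k B where
    "h holomorphic_on unit_disc" "hardy_norm p h \<le> 1"
    "norm (h a) \<ge> 1 / 48 * (1 - norm a) powr - (1 / p)" "deriv h a = 0"
    "k holomorphic_on unit_disc" "hardy_norm p k \<le> 1"
    "k a = 0" "norm (deriv k a) \<ge> 1 / 48 * (1 - norm a) powr - (1 + 1 / p)"
    "\<And>w. w \<in> unit_disc \<Longrightarrow> norm (h w) \<le> B \<and> norm (deriv h w) \<le> B \<and>
      norm (k w) \<le> B \<and> norm (deriv k w) \<le> B"
proof -
  define s where "s = 1 / p"
  define q where "q = 1 - (norm a)\<^sup>2"
  define Q where "Q = q powr (2 - s)"
  define D where "D = (\<lambda>w. 1 - cnj a * w)"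
  \<comment> \<open>At \<open>a\<close> the logarithmic derivative of the first factor is
    \<open>2 * cnj a / D a\<close>, and the involution has value 0 and derivative
    \<open>- 1 / D a\<close>; hence the coefficient \<open>2 * cnj a\<close>. The bracket has norm
    at most 3 and \<open>hardy_norm_le_kernel\<close> costs 4, so dividing by 12 makes the Hardy
    norm at most 1.\<close>
  define h where "h = (\<lambda>w. of_real (Q / 12) / (D w)\<^sup>2 * (1 + 2 * cnj a * ((a - w) / D w)))"
  define k where "k = (\<lambda>w. of_real (Q / 12) / (D w)\<^sup>2 * ((a - w) / D w))"
  have na: "norm a < 1" using a by simp
  have q: "0 < q" using a by (simp add: q_def power_less_one_iff abs_square_less_1)
  have q2: "q \<le> 2 * (1 - norm a)"
  proof -
    have "q = (1 - norm a) * (1 + norm a)" by (simp add: q_def power2_eq_square algebra_simps)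
    also have "\<dots> \<le> (1 - norm a) * 2" using na by (intro mult_left_mono) auto
    finally show ?thesis by simp
  qed
  have Q: "0 < Q" using q by (simp add: Q_def)
  have Da: "D a = of_real q" using complex_norm_square[of a] by (simp add: D_def q_def mult.commute)
  define S where "S = {w. D w \<noteq> 0}"
  have "open S" unfolding S_def D_def by (intro open_Collect_neq continuous_intros)
  have D0: "D w \<noteq> 0" if "norm w \<le> 1" for w
    using norm_one_minus_cnj_mult_ge[OF that, of a] na by (auto simp: D_def)
  then have SS: "cball 0 1 \<subseteq> S" by (auto simp: S_def)
  have hol: "h holomorphic_on S" "k holomorphic_on S"
    unfolding h_def k_def D_def
    by (intro holomorphic_intros; use \<open>open S\<close> in \<open>auto simp: S_def D_def\<close>)+
  have sub: "unit_disc \<subseteq> S" using SS ball_subset_cball by blast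
  have M: "norm ((a - w) / D w) \<le> 1" if w: "w \<in> unit_disc" for w
  proof -
    have "norm (Moebius_function 0 a w) < 1"
      using w na by (intro Moebius_function_norm_lt_1) auto
    then show ?thesis by (simp add: Moebius_function_simple D_def norm_divide norm_minus_commute)
  qed
  have bound: "norm (of_real (Q / 12) / (D w)\<^sup>2 * g) \<le>
      (1 / 4) * (1 - (norm a)\<^sup>2) powr (2 - 1 / p) / (norm (1 - cnj a * w))\<^sup>2" if "norm g \<le> 3" for w g
  proof -
    have "norm (of_real (Q / 12) / (D w)\<^sup>2 * g) = Q / 12 / (norm (D w))\<^sup>2 * norm g"
      using Q by (simp add: norm_mult norm_divide norm_power)
    also have "\<dots> \<le> Q / 12 / (norm (D w))\<^sup>2 * 3"
      using Q that by (intro mult_left_mono) auto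
    finally show ?thesis by (simp add: Q_def q_def D_def s_def)
  qed
  have nh: "hardy_norm p h \<le> ennreal (4 * (1 / 4))"
  proof (rule hardy_norm_le_kernel[OF p a])
    show "h holomorphic_on unit_disc" using hol sub holomorphic_on_subset by blast
    fix w assume w: "w \<in> unit_disc"
    have "norm (1 + 2 * cnj a * ((a - w) / D w)) \<le> 1 + 2 * (norm a * norm ((a - w) / D w))"
      by (rule order_trans[OF norm_triangle_ineq]) (simp add: norm_mult norm_divide)
    also have "norm a * norm ((a - w) / D w) \<le> 1 * 1"
      using na M[OF w] by (intro mult_mono) auto
    finally have "norm (1 + 2 * cnj a * ((a - w) / D w)) \<le> 3" by simp
    then show "norm (h w) \<le> (1 / 4) * (1 - (norm a)\<^sup>2) powr (2 - 1 / p) / (norm (1 - cnj a * w))\<^sup>2"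
      unfolding h_def by (rule bound)
  qed simp
  have nk: "hardy_norm p k \<le> ennreal (4 * (1 / 4))"
  proof (rule hardy_norm_le_kernel[OF p a])
    show "k holomorphic_on unit_disc" using hol sub holomorphic_on_subset by blast
    fix w assume w: "w \<in> unit_disc"
    show "norm (k w) \<le> (1 / 4) * (1 - (norm a)\<^sup>2) powr (2 - 1 / p) / (norm (1 - cnj a * w))\<^sup>2"
      unfolding k_def using M[OF w] by (intro bound) auto
  qed simp
  have Da0: "D a \<noteq> 0" using Da q by simp
  have dD: "(D has_field_derivative - cnj a) (at a)"
    unfolding D_def by (auto intro!: derivative_eq_intros)
  have dF: "((\<lambda>w. of_real (Q / 12) / (D w)\<^sup>2) has_field_derivative
      of_real (Q / 12) * (2 * cnj a) / (D a) ^ 3) (at a)"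
    by (rule derivative_eq_intros dD refl | use Da0 in \<open>simp add: field_simps eval_nat_numeral\<close>)+
  have dM: "((\<lambda>w. (a - w) / D w) has_field_derivative - 1 / D a) (at a)"
    by (rule derivative_eq_intros dD refl | use Da0 in \<open>simp add: field_simps\<close>)+
  have dk: "(k has_field_derivative - of_real (Q / 12) / (D a) ^ 3) (at a)"
    unfolding k_def
    by (rule DERIV_mult[OF dF dM, THEN DERIV_cong]) (use Da0 in \<open>simp add: field_simps eval_nat_numeral\<close>)
  have dh: "(h has_field_derivative 0) (at a)"
    unfolding h_def
    by (rule DERIV_mult[OF dF DERIV_add[OF DERIV_const DERIV_cmult[OF dM, of "2 * cnj a"]], THEN DERIV_cong])
      (use Da0 in \<open>simp add: field_simps eval_nat_numeral\<close>)
  \<comment> \<open>Replacing \<open>q\<close> by \<open>2 * (1 - norm a)\<close> costs at most 2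
    for the value and 4 for the derivative; with the 12 from the normalisation,
    \<open>1 / 48\<close> covers both.\<close>
  have qs: "q powr - s \<ge> (1 - norm a) powr - s / 2" "q powr - (1 + s) \<ge> (1 - norm a) powr - (1 + s) / 4"
  proof -
    have s: "0 \<le> s" "s \<le> 1" using p by (auto simp: s_def)
    have gen: "q powr - t \<ge> (1 - norm a) powr - t / 2 powr t" if "0 \<le> t" for t
    proof -
      have "(1 - norm a) powr - t / 2 powr t = (2 * (1 - norm a)) powr - t"
        using na powr_mult[of 2 "1 - norm a" "- t"] by (simp add: powr_minus field_simps)
      also have "\<dots> \<le> q powr - t" using q q2 that by (intro powr_mono2') auto
      finally show ?thesis .
    qed
    have "(1 - norm a) powr - s / 2 = (1 - norm a) powr - s / 2 powr 1" by simp
    also have "\<dots> \<le> (1 - norm a) powr - s / 2 powr s"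
      using s by (intro divide_left_mono powr_mono) auto
    also have "\<dots> \<le> q powr - s" by (rule gen[OF s(1)])
    finally show "q powr - s \<ge> (1 - norm a) powr - s / 2" .
    have "(1 - norm a) powr - (1 + s) / 4 = (1 - norm a) powr - (1 + s) / 2 powr 2" by simp
    also have "\<dots> \<le> (1 - norm a) powr - (1 + s) / 2 powr (1 + s)"
      using s by (intro divide_left_mono powr_mono) auto
    also have "\<dots> \<le> q powr - (1 + s)" using s by (intro gen) auto
    finally show "q powr - (1 + s) \<ge> (1 - norm a) powr - (1 + s) / 4" .
  qed
  have Qq: "Q = q powr - s * q\<^sup>2" "Q = q powr - (1 + s) * q ^ 3"
  proof -
    show "Q = q powr - s * q\<^sup>2"
      using q powr_add[of q "- s" 2] by (simp add: Q_def)
    show "Q = q powr - (1 + s) * q ^ 3"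
      using q powr_add[of q "- (1 + s)" 3] by (simp add: Q_def)
  qed
  have "h a = of_real (q powr - s / 12)"
    unfolding h_def Da Qq(1) using q by (simp add: power2_eq_square)
  then have "norm (h a) = q powr - s / 12" by (simp only: norm_of_real) simp
  then have ha: "norm (h a) \<ge> 1 / 48 * (1 - norm a) powr - s"
    using qs(1) powr_ge_zero[of "1 - norm a" "- s"] by linarith
  have "deriv k a = - of_real (q powr - (1 + s) / 12)"
    unfolding DERIV_imp_deriv[OF dk] Da Qq(2) using q by (simp add: power3_eq_cube)
  then have "norm (deriv k a) = q powr - (1 + s) / 12" by (simp only: norm_minus_cancel norm_of_real) simp
  then have ka: "norm (deriv k a) \<ge> 1 / 48 * (1 - norm a) powr - (1 + s)"
    using qs(2) by linarith
  obtain B1 where B1: "\<forall>w\<in>unit_disc. norm (h w) \<le> B1 \<and> norm (deriv h w) \<le> B1"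
    using holomorphic_bounded_with_deriv[OF hol(1) \<open>open S\<close> SS] by blast
  obtain B2 where B2: "\<forall>w\<in>unit_disc. norm (k w) \<le> B2 \<and> norm (deriv k w) \<le> B2"
    using holomorphic_bounded_with_deriv[OF hol(2) \<open>open S\<close> SS] by blast
  show ?thesis
  proof (rule that[of h k "max B1 B2"])
    show "h holomorphic_on unit_disc" "k holomorphic_on unit_disc"
      using hol sub holomorphic_on_subset by blast+
    show "k a = 0" by (simp add: k_def)
    show "deriv h a = 0" using dh by (rule DERIV_imp_deriv)
    show "hardy_norm p h \<le> 1" "hardy_norm p k \<le> 1" using nh nk by simp_all
    show "norm (h a) \<ge> 1 / 48 * (1 - norm a) powr - (1 / p)"
      "norm (deriv k a) \<ge> 1 / 48 * (1 - norm a) powr - (1 + 1 / p)"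
      using ha ka by (simp_all add: s_def)
    show "norm (h w) \<le> max B1 B2 \<and> norm (deriv h w) \<le> max B1 B2 \<and>
      norm (k w) \<le> max B1 B2 \<and> norm (deriv k w) \<le> max B1 B2" if "w \<in> unit_disc" for w
      using B1 B2 that by (auto simp: le_max_iff_disj)
  qed
qed

section \<open>Weighted composition operators into the Bloch space\<close>

lemma bloch_norm_leI:
  assumes "norm (f 0) \<le> a" "0 \<le> b"
    and "\<And>z. z \<in> unit_disc \<Longrightarrow> (1 - (norm z)\<^sup>2) * norm (deriv f z) \<le> b"
  shows "bloch_norm f \<le> ennreal (a + b)"
proof -
  have "0 \<le> a" using assms(1) norm_ge_zero order_trans by blast
  then show ?thesis
    unfolding bloch_norm_def using assms by (subst ennreal_plus) (auto intro!: add_mono SUP_least ennreal_leI)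
qed

lemma bloch_norm_leD:
  assumes "bloch_norm f \<le> ennreal b" "0 \<le> b" "z \<in> unit_disc"
  shows "(1 - (norm z)\<^sup>2) * norm (deriv f z) \<le> b"
proof -
  have "ennreal ((1 - (norm z)\<^sup>2) * norm (deriv f z)) \<le>
      (SUP z\<in>unit_disc. ennreal ((1 - (norm z)\<^sup>2) * norm (deriv f z)))"
    using assms(3) by (intro SUP_upper) auto
  also have "\<dots> \<le> bloch_norm f" by (simp add: bloch_norm_def)
  also have "\<dots> \<le> ennreal b" by fact
  finally show ?thesis using assms(2) by simp
qed

text \<open>On the convex disc \<open>g\<close> has a primitive \<open>G\<close>, and the integral
  along the radius to \<open>x\<close> is \<open>G x - G 0\<close>.\<close>

lemma has_field_derivative_contour_integral_linepath:
  assumes hol: "g holomorphic_on unit_disc" and z: "z \<in> unit_disc"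
  shows "((\<lambda>z. contour_integral (linepath 0 z) g) has_field_derivative g z) (at z)"
proof -
  obtain G where G: "\<And>x. x \<in> unit_disc \<Longrightarrow> (G has_field_derivative g x) (at x)"
    using holomorphic_convex_primitive'[OF convex_ball open_ball hol] at_within_open open_ball by metis
  have eq: "contour_integral (linepath 0 x) g = G x - G 0" if x: "x \<in> unit_disc" for x
  proof -
    have "closed_segment 0 x \<subseteq> unit_disc"
      using x by (intro closed_segment_subset convex_ball) auto
    then have "(g has_contour_integral (G (pathfinish (linepath 0 x)) - G (pathstart (linepath 0 x)))) (linepath 0 x)"
      using contour_integral_primitive[of unit_disc G g "linepath 0 x"] G
      by (auto intro: has_field_derivative_at_within simp del: pathstart_linepath pathfinish_linepath)
    then show ?thesis by (simp add: contour_integral_unique)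
  qed
  show ?thesis
    by (rule has_field_derivative_transform_within_open[of "\<lambda>x. G x - G 0" _ _ unit_disc])
      (use z eq in \<open>auto intro!: derivative_eq_intros G\<close>)
qed

text \<open>A growth class is locally bounded, hence normal. The limit inherits the size bound with
  the same \<open>c\<close>, and \<open>growthI\<close> restores the derivative bound at the price
  of the factor 4.\<close>

lemma growth_Montel:
  fixes F :: "nat \<Rightarrow> complex \<Rightarrow> complex"
  assumes F: "\<And>n. growth s c (F n)" and s: "0 \<le> s" "s \<le> 1" and c: "0 \<le> c"
  obtains g \<sigma> where "growth s (4 * c) g" "strict_mono (\<sigma> :: nat \<Rightarrow> nat)"
    "\<And>d e. d < 1 \<Longrightarrow> 0 < e \<Longrightarrow> \<forall>\<^sub>F n in sequentially. \<forall>w. norm w \<le> d \<longrightarrow>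
      norm (F (\<sigma> n) w - g w) \<le> e \<and> norm (deriv (\<lambda>w. F (\<sigma> n) w - g w) w) \<le> e"
proof -
  have bnd: "\<exists>B. \<forall>h\<in>{h. growth s c h}. \<forall>z\<in>K. norm (h z) \<le> B" if K: "compact K" "K \<subseteq> unit_disc" for K
  proof -
    have "compact ((\<lambda>z. c * (1 - norm z) powr - s) ` K)"
      using K by (intro compact_continuous_image continuous_intros) auto
    then obtain B where B: "\<forall>z\<in>K. norm (c * (1 - norm z) powr - s) \<le> B"
      using compact_imp_bounded by (fastforce simp: bounded_iff)
    have "norm (h z) \<le> B" if "growth s c h" "z \<in> K" for h z
    proof -
      have "norm (h z) \<le> c * (1 - norm z) powr - s" using that K by (auto simp: growth_def)
      also have "\<dots> \<le> B" using B that by force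
      finally show ?thesis .
    qed
    then show ?thesis by blast
  qed
  obtain g \<sigma> where g: "g holomorphic_on unit_disc" and \<sigma>: "strict_mono (\<sigma> :: nat \<Rightarrow> nat)"
    and lim: "\<And>x. x \<in> unit_disc \<Longrightarrow> ((\<lambda>n. F (\<sigma> n) x) \<longlongrightarrow> g x) sequentially"
    and unif: "\<And>K. compact K \<Longrightarrow> K \<subseteq> unit_disc \<Longrightarrow> uniform_limit K (F \<circ> \<sigma>) g sequentially"
    by (rule Montel[of unit_disc "{h. growth s c h}" F]) (use bnd F in \<open>auto simp: growth_def\<close>)
  have "growth s (4 * c) g"
  proof (rule growthI[OF g s c])
    fix w assume w: "w \<in> unit_disc"
    show "norm (g w) \<le> c * (1 - norm w) powr - s"
      by (rule Lim_bounded[OF tendsto_norm[OF lim[OF w]], of 0]) (use F w in \<open>auto simp: growth_def\<close>)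
  qed
  moreover have "\<forall>\<^sub>F n in sequentially. \<forall>w. norm w \<le> d \<longrightarrow>
      norm (F (\<sigma> n) w - g w) \<le> e \<and> norm (deriv (\<lambda>w. F (\<sigma> n) w - g w) w) \<le> e"
    if d: "d < 1" and e: "0 < e" for d e
  proof -
    \<comment> \<open>Closeness \<open>m\<close> on the larger disc of radius
      \<open>(1 + d) / 2\<close> gives both bounds by \<open>e\<close>: directly for the values, by
      Cauchy's inequality for the derivatives.\<close>
    define m where "m = min e (e * (1 - d) / 2)"
    have m: "0 < m" "m \<le> e" "2 * m / (1 - d) \<le> e"
      using d e by (auto simp: m_def min_def field_simps)
    have "cball 0 ((1 + d) / 2) \<subseteq> unit_disc" using d by auto
    from unif[OF compact_cball this]
    have "\<forall>\<^sub>F n in sequentially. \<forall>w\<in>cball 0 ((1 + d) / 2). dist ((F \<circ> \<sigma>) n w) (g w) < m"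
      using m(1) unfolding uniform_limit_iff by blast
    then show ?thesis
    proof (rule eventually_mono, intro allI impI)
      fix n and w :: complex
      assume *: "\<forall>w\<in>cball 0 ((1 + d) / 2). dist ((F \<circ> \<sigma>) n w) (g w) < m" and w: "norm w \<le> d"
      have le: "norm (F (\<sigma> n) v - g v) \<le> m" if "norm v \<le> (1 + d) / 2" for v
        using * that by (force simp: dist_norm)
      have "norm (F (\<sigma> n) w - g w) \<le> m" using w d by (intro le) auto
      moreover have "norm (deriv (\<lambda>w. F (\<sigma> n) w - g w) w) \<le> 2 * m / (1 - d)"
      proof (rule norm_deriv_le_of_bound[OF _ w d])
        show "(\<lambda>w. F (\<sigma> n) w - g w) holomorphic_on unit_disc"
          using F g by (auto simp: growth_def intro: holomorphic_intros)
      qed (rule le)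
      ultimately show "norm (F (\<sigma> n) w - g w) \<le> e \<and> norm (deriv (\<lambda>w. F (\<sigma> n) w - g w) w) \<le> e"
        using m by linarith
    qed
  qed
  ultimately show ?thesis using \<sigma> that by blast
qed

section \<open>The operator for fixed \<open>u\<close> and \<open>\<phi>\<close>, its derivative,
  and the two weights\<close>

locale weighted_composition =
  fixes u \<phi> :: "complex \<Rightarrow> complex"
  assumes u: "u holomorphic_on unit_disc" and \<phi>: "\<phi> holomorphic_on unit_disc"
    and \<phi>_self: "\<phi> ` unit_disc \<subseteq> unit_disc"
begin

text \<open>\<open>WI z\<close> is the weight with which \<open>deriv f (\<phi> z)\<close> enters
  \<open>(1 - (norm z)\<^sup>2) * norm (deriv (T f) z)\<close>; \<open>WJ z\<close> below is the
  weight of \<open>f (\<phi> z)\<close>.\<close>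

definition WI :: "complex \<Rightarrow> real" where
  "WI z = (1 - (norm z)\<^sup>2) * norm (u z * deriv \<phi> z)"

definition WJ :: "complex \<Rightarrow> real" where
  "WJ z = (1 - (norm z)\<^sup>2) * norm (deriv u z)"

abbreviation T :: "(complex \<Rightarrow> complex) \<Rightarrow> complex \<Rightarrow> complex" where
  "T \<equiv> weighted_comp u \<phi>"

lemma \<phi>_in_disc: "z \<in> unit_disc \<Longrightarrow> \<phi> z \<in> unit_disc"
  using \<phi>_self by blast

lemma norm_\<phi>: "z \<in> unit_disc \<Longrightarrow> 0 \<le> norm (\<phi> z) \<and> norm (\<phi> z) < 1"
  using \<phi>_in_disc by fastforce

lemma disc_weight_pos: "z \<in> unit_disc \<Longrightarrow> 0 < 1 - (norm z)\<^sup>2"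
  by (simp add: abs_square_less_1)

lemma W_nonneg: "z \<in> unit_disc \<Longrightarrow> 0 \<le> WI z" "z \<in> unit_disc \<Longrightarrow> 0 \<le> WJ z"
  unfolding WI_def WJ_def
  by (intro mult_nonneg_nonneg less_imp_le[OF disc_weight_pos] norm_ge_zero; assumption)+

text \<open>The integral vanishes at the origin, so only the supremum in the Bloch norm remains. The
  derivative of \<open>\<phi> z ^ j\<close> supplies the factor \<open>j\<close> that raises the
  exponent to \<open>1 + s\<close>. At \<open>j = 0\<close> both sides are 0, since
  \<open>0 powr s = 0\<close>.\<close>

lemma bloch_norm_I_op:
  assumes s: "0 < s"
  shows "ennreal (real j powr s) * bloch_norm (I_op u (\<lambda>z. \<phi> z ^ j)) =
    (SUP z\<in>unit_disc. ennreal (real j powr (1 + s) * (WI z * norm (\<phi> z) ^ (j - 1))))"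
proof -
  have dg: "deriv (\<lambda>z. \<phi> z ^ j) z = of_nat j * \<phi> z ^ (j - 1) * deriv \<phi> z" if "z \<in> unit_disc" for z
    using DERIV_power[OF holomorphic_derivI[OF \<phi> open_ball that], of j]
    by (intro DERIV_imp_deriv) (simp add: mult_ac)
  have hol: "(\<lambda>\<xi>. deriv (\<lambda>z. \<phi> z ^ j) \<xi> * u \<xi>) holomorphic_on unit_disc"
    by (intro holomorphic_intros u \<phi>) auto
  have d: "deriv (I_op u (\<lambda>z. \<phi> z ^ j)) z = of_nat j * \<phi> z ^ (j - 1) * deriv \<phi> z * u z"
    if z: "z \<in> unit_disc" for z
    using DERIV_imp_deriv[OF has_field_derivative_contour_integral_linepath[OF hol z]] dg[OF z]
    unfolding I_op_def by simp
  have "bloch_norm (I_op u (\<lambda>z. \<phi> z ^ j)) =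
      (SUP z\<in>unit_disc. ennreal ((1 - (norm z)\<^sup>2) * norm (deriv (I_op u (\<lambda>z. \<phi> z ^ j)) z)))"
    by (simp add: bloch_norm_def I_op_def)
  also have "\<dots> = (SUP z\<in>unit_disc. ennreal (real j * (WI z * norm (\<phi> z) ^ (j - 1))))"
    by (rule SUP_cong[OF refl]) (simp add: d WI_def norm_mult norm_power mult_ac)
  finally have "ennreal (real j powr s) * bloch_norm (I_op u (\<lambda>z. \<phi> z ^ j)) =
      (SUP z\<in>unit_disc. ennreal (real j powr s) * ennreal (real j * (WI z * norm (\<phi> z) ^ (j - 1))))"
    by (simp add: SUP_mult_left_ennreal)
  also have "\<dots> = (SUP z\<in>unit_disc. ennreal (real j powr (1 + s) * (WI z * norm (\<phi> z) ^ (j - 1))))"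
    by (rule SUP_cong[OF refl])
      (use W_nonneg in \<open>auto simp: ennreal_mult[symmetric] powr_add mult_ac simp del: mem_ball_0\<close>)
  finally show ?thesis .
qed

lemma bloch_norm_J_op:
  "ennreal (real j powr s) * bloch_norm (J_op u (\<lambda>z. \<phi> z ^ (j - 1))) =
    (SUP z\<in>unit_disc. ennreal (real j powr s * (WJ z * norm (\<phi> z) ^ (j - 1))))"
proof -
  have hol: "(\<lambda>\<xi>. \<phi> \<xi> ^ (j - 1) * deriv u \<xi>) holomorphic_on unit_disc"
    by (intro holomorphic_intros u \<phi>) auto
  have d: "deriv (J_op u (\<lambda>z. \<phi> z ^ (j - 1))) z = \<phi> z ^ (j - 1) * deriv u z" if z: "z \<in> unit_disc" for z
    using DERIV_imp_deriv[OF has_field_derivative_contour_integral_linepath[OF hol z]]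
    unfolding J_op_def by simp
  have "bloch_norm (J_op u (\<lambda>z. \<phi> z ^ (j - 1))) =
      (SUP z\<in>unit_disc. ennreal ((1 - (norm z)\<^sup>2) * norm (deriv (J_op u (\<lambda>z. \<phi> z ^ (j - 1))) z)))"
    by (simp add: bloch_norm_def J_op_def)
  also have "\<dots> = (SUP z\<in>unit_disc. ennreal (WJ z * norm (\<phi> z) ^ (j - 1)))"
    by (rule SUP_cong[OF refl]) (simp only: d WJ_def norm_mult norm_power mult_ac)
  finally have "ennreal (real j powr s) * bloch_norm (J_op u (\<lambda>z. \<phi> z ^ (j - 1))) =
      (SUP z\<in>unit_disc. ennreal (real j powr s) * ennreal (WJ z * norm (\<phi> z) ^ (j - 1)))"
    by (simp add: SUP_mult_left_ennreal)
  also have "\<dots> = (SUP z\<in>unit_disc. ennreal (real j powr s * (WJ z * norm (\<phi> z) ^ (j - 1))))"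
    by (rule SUP_cong[OF refl])
      (use W_nonneg in \<open>auto simp: ennreal_mult[symmetric] simp del: mem_ball_0\<close>)
  finally show ?thesis .
qed

lemma holomorphic_T:
  assumes "f holomorphic_on unit_disc"
  shows "T f holomorphic_on unit_disc"
  unfolding weighted_comp_def
  using holomorphic_on_compose_gen[OF \<phi> assms \<phi>_self] by (intro holomorphic_intros u) (simp add: o_def)

lemma deriv_T:
  assumes "f holomorphic_on unit_disc" "z \<in> unit_disc"
  shows "deriv (T f) z = deriv u z * f (\<phi> z) + u z * deriv \<phi> z * deriv f (\<phi> z)"
proof -
  have "\<phi> z \<in> unit_disc" using assms by (intro \<phi>_in_disc)
  then have "(f has_field_derivative deriv f (\<phi> z)) (at (\<phi> z))"
    using assms by (intro holomorphic_derivI) auto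
  then have "((\<lambda>z. f (\<phi> z)) has_field_derivative deriv f (\<phi> z) * deriv \<phi> z) (at z)"
    by (rule DERIV_chain2) (rule holomorphic_derivI[OF \<phi> open_ball assms(2)])
  then have "(T f has_field_derivative deriv u z * f (\<phi> z) + deriv f (\<phi> z) * deriv \<phi> z * u z) (at z)"
    unfolding weighted_comp_def by (intro DERIV_mult holomorphic_derivI[OF u open_ball assms(2)])
  then show ?thesis by (auto dest!: DERIV_imp_deriv)
qed

lemma T_diff: "(\<lambda>z. T f z - T g z) = T (\<lambda>w. f w - g w)"
  by (simp add: weighted_comp_def algebra_simps)

lemma deriv_T_le:
  assumes f: "f holomorphic_on unit_disc" and z: "z \<in> unit_disc"
  shows "(1 - (norm z)\<^sup>2) * norm (deriv (T f) z) \<le>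
    WJ z * norm (f (\<phi> z)) + WI z * norm (deriv f (\<phi> z))"
proof -
  have "norm (deriv (T f) z) \<le> norm (deriv u z) * norm (f (\<phi> z)) + norm (u z * deriv \<phi> z) * norm (deriv f (\<phi> z))"
    unfolding deriv_T[OF assms] by (rule order_trans[OF norm_triangle_ineq]) (simp add: norm_mult)
  then have "(1 - (norm z)\<^sup>2) * norm (deriv (T f) z) \<le> (1 - (norm z)\<^sup>2) *
      (norm (deriv u z) * norm (f (\<phi> z)) + norm (u z * deriv \<phi> z) * norm (deriv f (\<phi> z)))"
    using disc_weight_pos[OF z] by (intro mult_left_mono) auto
  then show ?thesis by (simp add: WI_def WJ_def algebra_simps)
qed

text \<open>Common source of all upper bounds. Where \<open>norm (\<phi> z) > \<delta>\<close>, the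
  growth of \<open>h\<close> meets weights bounded by \<open>L\<close>; elsewhere the smallness of
  \<open>h\<close> meets weights bounded by \<open>B\<close>. The choices
  \<open>\<delta> = - 1\<close> and \<open>\<delta> = 1\<close> leave only the first or only the
  second region.\<close>

lemma bloch_norm_T_le:
  assumes h: "growth s a h" and a: "0 \<le> a" and e: "0 \<le> e" and L: "0 \<le> L" and B: "0 \<le> B"
    and far: "\<And>z. z \<in> unit_disc \<Longrightarrow> \<delta> < norm (\<phi> z) \<Longrightarrow>
      WI z * (1 - norm (\<phi> z)) powr - (1 + s) \<le> L \<and> WJ z * (1 - norm (\<phi> z)) powr - s \<le> L"
    and near: "\<And>z. z \<in> unit_disc \<Longrightarrow> norm (\<phi> z) \<le> \<delta> \<Longrightarrow> WI z \<le> B \<and> WJ z \<le> B"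
    and small: "\<And>w. w \<in> unit_disc \<Longrightarrow> norm w \<le> \<delta> \<Longrightarrow> norm (h w) \<le> e \<and> norm (deriv h w) \<le> e"
    and h0: "norm (h (\<phi> 0)) \<le> e"
  shows "bloch_norm (T h) \<le> ennreal (norm (u 0) * e + (2 * a * L + 2 * B * e))"
proof (rule bloch_norm_leI)
  have hol: "h holomorphic_on unit_disc" using h by (simp add: growth_def)
  show "norm (T h 0) \<le> norm (u 0) * e"
    unfolding weighted_comp_def norm_mult using h0 by (intro mult_left_mono) auto
  fix z assume z: "z \<in> unit_disc"
  have \<phi>z: "\<phi> z \<in> unit_disc" using z by (rule \<phi>_in_disc)
  have "WJ z * norm (h (\<phi> z)) + WI z * norm (deriv h (\<phi> z)) \<le> 2 * a * L + 2 * B * e"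
  proof (cases "\<delta> < norm (\<phi> z)")
    case True
    have "WJ z * norm (h (\<phi> z)) \<le> WJ z * (a * (1 - norm (\<phi> z)) powr - s)"
      using h \<phi>z W_nonneg[OF z] by (intro mult_left_mono) (auto simp: growth_def)
    also have "\<dots> = a * (WJ z * (1 - norm (\<phi> z)) powr - s)" by (simp only: mult_ac)
    also have "\<dots> \<le> a * L" using far[OF z True] a by (intro mult_left_mono) auto
    finally have 1: "WJ z * norm (h (\<phi> z)) \<le> a * L" .
    have "WI z * norm (deriv h (\<phi> z)) \<le> WI z * (a * (1 - norm (\<phi> z)) powr - (1 + s))"
      using h \<phi>z W_nonneg[OF z] by (intro mult_left_mono) (auto simp: growth_def)
    also have "\<dots> = a * (WI z * (1 - norm (\<phi> z)) powr - (1 + s))" by (simp only: mult_ac)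
    also have "\<dots> \<le> a * L" using far[OF z True] a by (intro mult_left_mono) auto
    finally have 2: "WI z * norm (deriv h (\<phi> z)) \<le> a * L" .
    have "0 \<le> B * e" using B e by simp
    then show ?thesis using 1 2 by linarith
  next
    case False
    have "WJ z * norm (h (\<phi> z)) \<le> B * e" "WI z * norm (deriv h (\<phi> z)) \<le> B * e"
      using False near[OF z] small[OF \<phi>z] B by (auto intro!: mult_mono)
    moreover have "0 \<le> a * L" using a L by simp
    ultimately show ?thesis by linarith
  qed
  then show "(1 - (norm z)\<^sup>2) * norm (deriv (T h) z) \<le> 2 * a * L + 2 * B * e"
    using deriv_T_le[OF hol z] by linarith
qed (use a L B e in auto)

end

section \<open>Compactness and essential norm\<close>

lemma tendsto_0_if_le_ennreal:
  fixes f :: "nat \<Rightarrow> ennreal"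
  assumes "\<And>e. 0 < e \<Longrightarrow> \<forall>\<^sub>F n in sequentially. f n \<le> ennreal e"
  shows "f \<longlonglongrightarrow> 0"
proof (rule order_tendstoI)
  fix a :: ennreal assume "0 < a"
  then obtain b where b: "0 < b" "b < a" using dense by blast
  then have "ennreal (enn2real b) = b" "0 < enn2real b"
    by (auto simp: enn2real_positive_iff intro: less_trans[OF _ le_less_trans] dest: less_le_trans[OF _ top_greatest])
  then show "\<forall>\<^sub>F n in sequentially. f n < a"
    using assms[of "enn2real b"] b by (auto elim: eventually_mono)
qed simp

context weighted_composition
begin

text \<open>With \<open>\<delta> = - 1\<close> this is the global bound that characterises
  boundedness; with \<open>\<delta>\<close> close to 1 it describes the behaviour as
  \<open>norm (\<phi> z)\<close> tends to 1, and it is vacuous if no such \<open>z\<close>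
  exist.\<close>

definition weights_le :: "real \<Rightarrow> real \<Rightarrow> real \<Rightarrow> bool" where
  "weights_le s \<delta> L \<longleftrightarrow> (\<forall>z\<in>unit_disc. \<delta> < norm (\<phi> z) \<longrightarrow>
    WI z * (1 - norm (\<phi> z)) powr - (1 + s) \<le> L \<and> WJ z * (1 - norm (\<phi> z)) powr - s \<le> L)"

text \<open>Shows that the bare weights tend to 0 as \<open>norm (\<phi> z)\<close> tends to 1, so
  that a fixed bounded function with bounded derivative contributes nothing in the limit. The extra
  power available for \<open>WI\<close> is given up, as
  \<open>1 - norm (\<phi> z) \<le> 1\<close>.\<close>

lemma weights_le_powr:
  assumes M: "weights_le s (- 1) M" and s: "0 < s" and z: "z \<in> unit_disc" and "0 \<le> M"
  shows "WI z \<le> M * (1 - norm (\<phi> z)) powr s" "WJ z \<le> M * (1 - norm (\<phi> z)) powr s"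
proof -
  define y where "y = 1 - norm (\<phi> z)"
  have y: "0 < y" "y \<le> 1" using norm_\<phi>[OF z] by (auto simp: y_def)
  have *: "y powr t * y powr - t = 1" for t using y by (simp flip: powr_add)
  have n: "- 1 < norm (\<phi> z)" using norm_ge_zero[of "\<phi> z"] by linarith
  have M: "WI z * y powr - (1 + s) \<le> M" "WJ z * y powr - s \<le> M"
    using M z n by (auto simp: weights_le_def y_def)
  have "WI z = (WI z * y powr - (1 + s)) * y powr (1 + s)"
    using *[of "1 + s"] by (simp only: mult_ac mult_1_right)
  also have "\<dots> \<le> M * y powr (1 + s)"
    using M by (intro mult_right_mono) auto
  also have "\<dots> \<le> M * y powr s"
    using y s \<open>0 \<le> M\<close> by (intro mult_left_mono powr_mono') auto
  finally show "WI z \<le> M * (1 - norm (\<phi> z)) powr s" by (simp add: y_def)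
  have "WJ z = (WJ z * y powr - s) * y powr s"
    using *[of s] by (simp only: mult_ac mult_1_right)
  also have "\<dots> \<le> M * y powr s"
    using M by (intro mult_right_mono) auto
  finally show "WJ z \<le> M * (1 - norm (\<phi> z)) powr s" by (simp add: y_def)
qed

lemma weights_le_bound:
  assumes "weights_le s (- 1) M" "0 < s" "z \<in> unit_disc" "0 \<le> M"
  shows "WI z \<le> M" "WJ z \<le> M"
proof -
  have "(1 - norm (\<phi> z)) powr s \<le> 1 powr s"
    using norm_\<phi>[OF assms(3)] assms(2) by (intro powr_mono2) auto
  then have "M * (1 - norm (\<phi> z)) powr s \<le> M"
    using assms(4) by (simp add: mult_left_le)
  then show "WI z \<le> M" "WJ z \<le> M"
    using weights_le_powr[OF assms] by linarith+
qed

lemma bloch_norm_T_growth: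
  assumes h: "growth s a h" and a: "0 \<le> a" and M: "weights_le s (- 1) M" "0 \<le> M"
  shows "bloch_norm (T h) \<le> ennreal (a * (norm (u 0) * (1 - norm (\<phi> 0)) powr - s + 2 * M))"
proof -
  have "bloch_norm (T h) \<le> ennreal (norm (u 0) * (a * (1 - norm (\<phi> 0)) powr - s) +
      (2 * a * M + 2 * 0 * (a * (1 - norm (\<phi> 0)) powr - s)))"
  \<comment> \<open>No norm is at most \<open>- 1\<close>, so the near region is empty and
    \<open>B = 0\<close> is admissible; the role of \<open>e\<close> is reduced to bounding
    \<open>h\<close> at \<open>\<phi> 0\<close>.\<close>
  proof (rule bloch_norm_T_le[OF h, where \<delta> = "- 1"])
    show "norm (h (\<phi> 0)) \<le> a * (1 - norm (\<phi> 0)) powr - s"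
      using h \<phi>_in_disc[of 0] by (auto simp: growth_def)
    show "WI z \<le> 0 \<and> WJ z \<le> 0" if "norm (\<phi> z) \<le> - 1" for z
      using that norm_ge_zero[of "\<phi> z"] by linarith
    show "norm (h w) \<le> a * (1 - norm (\<phi> 0)) powr - s \<and> norm (deriv h w) \<le> a * (1 - norm (\<phi> 0)) powr - s"
      if "norm w \<le> - 1" for w using that norm_ge_zero[of w] by linarith
  qed (use a M in \<open>auto simp: weights_le_def\<close>)
  then show ?thesis by (simp add: algebra_simps)
qed

lemma T_in_bloch:
  assumes "growth s a h" "0 \<le> a" "weights_le s (- 1) M" "0 \<le> M"
  shows "T h \<in> fspace bloch_norm"
  using le_less_trans[OF bloch_norm_T_growth[OF assms]] assms(1)
  by (auto simp: fspace_def growth_def intro: holomorphic_T)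

lemma bounded_op_T_if:
  assumes p: "1 \<le> p" and M: "weights_le (1 / p) (- 1) M" "0 \<le> M"
  shows "bounded_op (hardy_norm p) bloch_norm T"
proof -
  have gr: "growth (1 / p) (16 * enn2real (hardy_norm p f)) f"
    and fin: "ennreal (enn2real (hardy_norm p f)) = hardy_norm p f"
    if "f \<in> fspace (hardy_norm p)" for f
  proof -
    show fin: "ennreal (enn2real (hardy_norm p f)) = hardy_norm p f"
      using that by (simp add: fspace_def)
    show "growth (1 / p) (16 * enn2real (hardy_norm p f)) f"
      using fin by (intro hardy_growth[OF p that]) auto
  qed
  have "linear_op (hardy_norm p) bloch_norm T"
    unfolding linear_op_def using T_in_bloch[OF gr _ M]
    by (auto simp: weighted_comp_def algebra_simps)
  moreover have "bloch_norm (T f) \<le>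
      ennreal (16 * (norm (u 0) * (1 - norm (\<phi> 0)) powr - (1 / p) + 2 * M)) * hardy_norm p f"
    if f: "f \<in> fspace (hardy_norm p)" for f
  proof -
    have "bloch_norm (T f) \<le> ennreal (16 * enn2real (hardy_norm p f) *
        (norm (u 0) * (1 - norm (\<phi> 0)) powr - (1 / p) + 2 * M))"
      by (rule bloch_norm_T_growth[OF gr[OF f] _ M]) simp
    also have "\<dots> = ennreal (16 * (norm (u 0) * (1 - norm (\<phi> 0)) powr - (1 / p) + 2 * M) *
        enn2real (hardy_norm p f))"
      by (simp only: mult_ac)
    also have "\<dots> = ennreal (16 * (norm (u 0) * (1 - norm (\<phi> 0)) powr - (1 / p) + 2 * M)) *
        ennreal (enn2real (hardy_norm p f))"
      using M by (intro ennreal_mult) auto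
    finally show ?thesis by (simp only: fin[OF f])
  qed
  ultimately show ?thesis unfolding bounded_op_def by blast
qed

text \<open>The function \<open>k\<close> vanishes at \<open>\<phi> z\<close> and isolates
  \<open>WI z\<close>; the derivative of \<open>h\<close> vanishes there and \<open>WJ z\<close> is
  isolated. The factor 48 inverts their lower bounds. The boundedness clause in \<open>le\<close>
  restricts the functions on which the estimate has to be checked.\<close>

lemma weights_le_of_test:
  assumes p: "1 \<le> p" and z: "z \<in> unit_disc"
    and le: "\<And>f. f \<in> fspace (hardy_norm p) \<Longrightarrow> hardy_norm p f \<le> 1 \<Longrightarrow>
      \<exists>B. \<forall>w\<in>unit_disc. norm (f w) \<le> B \<and> norm (deriv f w) \<le> B \<Longrightarrow>
      (1 - (norm z)\<^sup>2) * norm (deriv (T f) z) \<le> C"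
  shows "WI z * (1 - norm (\<phi> z)) powr - (1 + 1 / p) \<le> 48 * C"
    and "WJ z * (1 - norm (\<phi> z)) powr - (1 / p) \<le> 48 * C"
proof -
  obtain h k B where hk:
    "h holomorphic_on unit_disc" "hardy_norm p h \<le> 1"
    "norm (h (\<phi> z)) \<ge> 1 / 48 * (1 - norm (\<phi> z)) powr - (1 / p)" "deriv h (\<phi> z) = 0"
    "k holomorphic_on unit_disc" "hardy_norm p k \<le> 1"
    "k (\<phi> z) = 0" "norm (deriv k (\<phi> z)) \<ge> 1 / 48 * (1 - norm (\<phi> z)) powr - (1 + 1 / p)"
    "\<And>w. w \<in> unit_disc \<Longrightarrow> norm (h w) \<le> B \<and> norm (deriv h w) \<le> B \<and>
      norm (k w) \<le> B \<and> norm (deriv k w) \<le> B"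
    by (rule hardy_test_functions[OF p \<phi>_in_disc[OF z]]) (rule that)
  have "hardy_norm p h < \<infinity>" "hardy_norm p k < \<infinity>"
    using hk(2,6) by (auto intro: le_less_trans[of _ 1])
  then have sp: "h \<in> fspace (hardy_norm p)" "k \<in> fspace (hardy_norm p)"
    using hk by (auto simp: fspace_def)
  have "WI z * (1 / 48 * (1 - norm (\<phi> z)) powr - (1 + 1 / p)) \<le> WI z * norm (deriv k (\<phi> z))"
    using hk W_nonneg[OF z] by (intro mult_left_mono) auto
  also have "\<dots> = (1 - (norm z)\<^sup>2) * norm (deriv (T k) z)"
    using hk by (simp add: deriv_T[OF _ z] WI_def norm_mult)
  also have "\<dots> \<le> C" using sp hk by (intro le) blast+
  finally show "WI z * (1 - norm (\<phi> z)) powr - (1 + 1 / p) \<le> 48 * C" by simp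
  have "WJ z * (1 / 48 * (1 - norm (\<phi> z)) powr - (1 / p)) \<le> WJ z * norm (h (\<phi> z))"
    using hk W_nonneg[OF z] by (intro mult_left_mono) auto
  also have "\<dots> = (1 - (norm z)\<^sup>2) * norm (deriv (T h) z)"
    using hk by (simp add: deriv_T[OF _ z] WJ_def norm_mult)
  also have "\<dots> \<le> C" using sp hk by (intro le) blast+
  finally show "WJ z * (1 - norm (\<phi> z)) powr - (1 / p) \<le> 48 * C" by simp
qed

lemma weights_le_if_bounded_op:
  assumes p: "1 \<le> p" and T: "bounded_op (hardy_norm p) bloch_norm T"
  obtains M where "weights_le (1 / p) (- 1) M" "0 \<le> M"
proof -
  obtain C :: real where C: "\<And>f. f \<in> fspace (hardy_norm p) \<Longrightarrow> bloch_norm (T f) \<le> ennreal C * hardy_norm p f"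
    using T unfolding bounded_op_def by blast
  have "(1 - (norm z)\<^sup>2) * norm (deriv (T f) z) \<le> \<bar>C\<bar>"
    if "f \<in> fspace (hardy_norm p)" "hardy_norm p f \<le> 1" "z \<in> unit_disc" for f z
  proof (rule bloch_norm_leD[OF _ _ that(3)])
    have "bloch_norm (T f) \<le> ennreal C * hardy_norm p f" by (rule C[OF that(1)])
    also have "\<dots> \<le> ennreal \<bar>C\<bar> * 1" using that by (intro mult_mono ennreal_leI) auto
    finally show "bloch_norm (T f) \<le> ennreal \<bar>C\<bar>" by simp
  qed simp
  then have "weights_le (1 / p) (- 1) (48 * \<bar>C\<bar>)"
    unfolding weights_le_def using weights_le_of_test[OF p] by blast
  then show ?thesis using that by simp
qed

text \<open>On \<open>H\<^sup>1\<close> the test functions need not converge weakly to \<open>0\<close>. Instead, differences of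
  two of them along a subsequence on which \<open>K\<close> converges are used; the earlier one is negligible
  near the points \<open>z\<close> with \<open>norm (\<phi> z)\<close> close to \<open>1\<close>.\<close>

lemma test_le_op_norm_diff:
  assumes M: "weights_le s (- 1) M" "0 \<le> M" and s: "0 < s"
    and K: "compact_op N bloch_norm K"
    and T: "\<And>f. f \<in> fspace N \<Longrightarrow> T f \<in> fspace bloch_norm"
    and E: "op_norm N bloch_norm (\<lambda>f z. T f z - K f z) \<le> ennreal E" "0 \<le> E" and e: "0 < e"
  shows "\<exists>\<delta><1. \<forall>z\<in>unit_disc. \<delta> < norm (\<phi> z) \<longrightarrow> (\<forall>f. f \<in> fspace N \<and> N f \<le> 1 \<and>
    (\<exists>B. \<forall>w\<in>unit_disc. norm (f w) \<le> B \<and> norm (deriv f w) \<le> B) \<longrightarrow>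
      (1 - (norm z)\<^sup>2) * norm (deriv (T f) z) \<le> 2 * E + e)" (is "\<exists>\<delta><1. ?P \<delta>")
proof (rule ccontr)
  \<comment> \<open>If no \<open>\<delta>\<close> works, the thresholds
    \<open>1 - 1 / (n + 1)\<close> give a point and a test function violating the estimate for every
    \<open>n\<close>.\<close>
  define Q where "Q = (\<lambda>(n::nat) (z, f). z \<in> unit_disc \<and> 1 - inverse (real (Suc n)) < norm (\<phi> z) \<and>
    f \<in> fspace N \<and> N f \<le> 1 \<and>
    (\<exists>B. \<forall>w\<in>unit_disc. norm (f w) \<le> B \<and> norm (deriv f w) \<le> B) \<and>
    2 * E + e < (1 - (norm z)\<^sup>2) * norm (deriv (T f) z))"
  assume neg: "\<not> ?thesis"
  have "\<exists>zf. Q n zf" for n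
  proof -
    have "1 - inverse (real (Suc n)) < 1" by simp
    with neg have "\<not> ?P (1 - inverse (real (Suc n)))" by blast
    moreover have "?P (1 - inverse (real (Suc n)))" if "\<nexists>zf. Q n zf"
    proof (intro ballI impI allI, rule ccontr)
      fix z f
      assume "z \<in> unit_disc" "1 - inverse (real (Suc n)) < norm (\<phi> z)"
        "f \<in> fspace N \<and> N f \<le> 1 \<and> (\<exists>B. \<forall>w\<in>unit_disc. norm (f w) \<le> B \<and> norm (deriv f w) \<le> B)"
        "\<not> (1 - (norm z)\<^sup>2) * norm (deriv (T f) z) \<le> 2 * E + e"
      then have "Q n (z, f)" unfolding Q_def prod.case not_le by blast
      then show False using that by blast
    qed
    ultimately show ?thesis by blast
  qed
  then have "\<exists>zf. \<forall>n. Q n (zf n)" by (intro choice allI)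
  then obtain zf where zf: "\<And>n. Q n (zf n)" by blast
  define Z where "Z = (\<lambda>n. fst (zf n))"
  define F where "F = (\<lambda>n. snd (zf n))"
  have Q: "Z n \<in> unit_disc" "1 - inverse (real (Suc n)) < norm (\<phi> (Z n))"
    "F n \<in> fspace N" "N (F n) \<le> 1"
    "\<exists>B. \<forall>w\<in>unit_disc. norm (F n w) \<le> B \<and> norm (deriv (F n) w) \<le> B"
    "2 * E + e < (1 - (norm (Z n))\<^sup>2) * norm (deriv (T (F n)) (Z n))" for n
    using zf[of n] unfolding Q_def Z_def F_def case_prod_beta by blast+
  obtain g and \<sigma> :: "nat \<Rightarrow> nat" where g: "g \<in> fspace bloch_norm" and \<sigma>: "strict_mono \<sigma>"
    and lim: "(\<lambda>n. bloch_norm (\<lambda>z. K (F (\<sigma> n)) z - g z)) \<longlonglongrightarrow> 0"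
    using K Q(3,4) unfolding compact_op_def by meson
  have "\<forall>\<^sub>F n in sequentially. bloch_norm (\<lambda>z. K (F (\<sigma> n)) z - g z) < ennreal (e / 4)"
    using e by (intro order_tendstoD(2)[OF lim]) simp
  then obtain n0 where n0: "\<And>n. n \<ge> n0 \<Longrightarrow> bloch_norm (\<lambda>z. K (F (\<sigma> n)) z - g z) \<le> ennreal (e / 4)"
    unfolding eventually_sequentially by (auto intro: less_imp_le)
  \<comment> \<open>The earlier function is fixed first, so that its bound \<open>B\<close> is a
    constant when \<open>n\<close> is then sent to infinity.\<close>
  obtain B where B: "\<And>w. w \<in> unit_disc \<Longrightarrow> norm (F (\<sigma> n0) w) \<le> B \<and> norm (deriv (F (\<sigma> n0)) w) \<le> B"
    using Q(5)[of "\<sigma> n0"] by blast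
  have "norm (F (\<sigma> n0) 0) \<le> B" using B[of 0] by simp
  then have B0: "0 \<le> B" by (rule order_trans[OF norm_ge_zero])
  have "(\<lambda>n. 2 * B * M * inverse (real (Suc n)) powr s) \<longlonglongrightarrow> 2 * B * M * 0"
    using s by (intro tendsto_intros tendsto_zero_powrI[OF LIMSEQ_inverse_real_of_nat tendsto_const]) auto
  then have "\<forall>\<^sub>F n in sequentially. 2 * B * M * inverse (real (Suc n)) powr s < e / 4"
    using e by (intro order_tendstoD(2)) auto
  then have "\<forall>\<^sub>F n in sequentially. n0 \<le> n \<and> 2 * B * M * inverse (real (Suc n)) powr s < e / 4"
    by (intro eventually_conj eventually_ge_at_top)
  then obtain n where n: "n \<ge> n0" "2 * B * M * inverse (real (Suc n)) powr s < e / 4"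
    using eventually_happens'[OF sequentially_bot] by blast
  define z where "z = Z (\<sigma> n)"
  define q where "q = 1 - (norm z)\<^sup>2"
  define f1 where "f1 = F (\<sigma> n)"
  define f2 where "f2 = F (\<sigma> n0)"
  have z: "z \<in> unit_disc" using Q by (simp add: z_def)
  have q: "0 < q" using disc_weight_pos[OF z] by (simp add: q_def)
  have f12: "f1 \<in> fspace N" "f2 \<in> fspace N" "N f1 \<le> 1" "N f2 \<le> 1"
    using Q by (auto simp: f1_def f2_def)
  have TK: "q * norm (deriv (\<lambda>z. T f z - K f z) z) \<le> E" if "f \<in> fspace N" "N f \<le> 1" for f
    unfolding q_def
  proof (rule bloch_norm_leD[OF _ E(2) z])
    have "bloch_norm (\<lambda>z. T f z - K f z) \<le> op_norm N bloch_norm (\<lambda>f z. T f z - K f z)"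
      unfolding op_norm_def using that by (intro SUP_upper2[of f]) auto
    then show "bloch_norm (\<lambda>z. T f z - K f z) \<le> ennreal E" using E by simp
  qed
  have Kg: "q * norm (deriv (\<lambda>z. K f1 z - g z) z) \<le> e / 4" "q * norm (deriv (\<lambda>z. K f2 z - g z) z) \<le> e / 4"
    unfolding q_def f1_def f2_def using e n0 n by (intro bloch_norm_leD[OF _ _ z]; simp)+
  have diff: "f field_differentiable at z" if "f \<in> fspace bloch_norm" for f
    using that z by (auto simp: fspace_def intro: holomorphic_on_imp_differentiable_at[of _ unit_disc])
  have Kf: "K f1 \<in> fspace bloch_norm" "K f2 \<in> fspace bloch_norm"
    using K f12 by (auto simp: compact_op_def linear_op_def)
  note d = diff[OF T[OF f12(1)]] diff[OF T[OF f12(2)]] diff[OF Kf(1)] diff[OF Kf(2)] diff[OF g]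
  \<comment> \<open>Telescoping through \<open>K f1\<close>, \<open>g\<close> and
    \<open>K f2\<close>. The five terms cost \<open>E\<close>, \<open>e / 4\<close>,
    \<open>e / 4\<close>, \<open>E\<close>, and, for \<open>T f2\<close>, again less than
    \<open>e / 4\<close>; the sum stays below \<open>2 * E + e\<close>.\<close>
  have split: "deriv (T f1) z = deriv (\<lambda>z. T f1 z - K f1 z) z + deriv (\<lambda>z. K f1 z - g z) z
      - deriv (\<lambda>z. K f2 z - g z) z - deriv (\<lambda>z. T f2 z - K f2 z) z + deriv (T f2) z"
    using d by (simp add: deriv_diff)
  have tri: "norm (a + b - c - d + f) \<le> norm a + norm b + norm c + norm d + norm f" for a b c d f :: complex
    using norm_triangle_ineq[of "a + b - c - d" f] norm_triangle_ineq4[of "a + b - c" d]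
      norm_triangle_ineq4[of "a + b" c] norm_triangle_ineq[of a b] by linarith
  have "q * norm (deriv (T f1) z) \<le> q * (norm (deriv (\<lambda>z. T f1 z - K f1 z) z) + norm (deriv (\<lambda>z. K f1 z - g z) z)
      + norm (deriv (\<lambda>z. K f2 z - g z) z) + norm (deriv (\<lambda>z. T f2 z - K f2 z) z) + norm (deriv (T f2) z))"
    unfolding split using q by (intro mult_left_mono tri) auto
  then have le: "q * norm (deriv (T f1) z) \<le> q * norm (deriv (\<lambda>z. T f1 z - K f1 z) z) + q * norm (deriv (\<lambda>z. K f1 z - g z) z)
      + q * norm (deriv (\<lambda>z. K f2 z - g z) z) + q * norm (deriv (\<lambda>z. T f2 z - K f2 z) z) + q * norm (deriv (T f2) z)"
    by (simp only: distrib_left)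
  have "q * norm (deriv (T f2) z) \<le> WJ z * norm (f2 (\<phi> z)) + WI z * norm (deriv f2 (\<phi> z))"
    unfolding q_def using f12 by (intro deriv_T_le z) (auto simp: fspace_def)
  also have "\<dots> \<le> (M * (1 - norm (\<phi> z)) powr s) * B + (M * (1 - norm (\<phi> z)) powr s) * B"
    using weights_le_powr[OF M(1) s z M(2)] B[OF \<phi>_in_disc[OF z]] W_nonneg[OF z] M(2)
    by (intro add_mono mult_mono) (auto simp: f2_def)
  also have "\<dots> = 2 * B * M * (1 - norm (\<phi> z)) powr s" by (simp add: algebra_simps)
  also have "\<dots> \<le> 2 * B * M * inverse (real (Suc n)) powr s"
  proof (intro mult_left_mono powr_mono2)
    have "inverse (real (Suc (\<sigma> n))) \<le> inverse (real (Suc n))"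
      using seq_suble[OF \<sigma>, of n] by (intro le_imp_inverse_le) auto
    then show "1 - norm (\<phi> z) \<le> inverse (real (Suc n))"
      using Q(2)[of "\<sigma> n"] unfolding z_def by linarith
  qed (use B0 M s norm_\<phi>[OF z] in auto)
  finally have "q * norm (deriv (T f1) z) \<le> 2 * E + e"
    using le TK[OF f12(1,3)] TK[OF f12(2,4)] Kg n(2) e by linarith
  then show False using Q(6)[of "\<sigma> n"] by (simp add: q_def z_def f1_def)
qed

lemma weights_le_of_op_norm_diff:
  assumes p: "1 \<le> p" and T: "bounded_op (hardy_norm p) bloch_norm T"
    and K: "compact_op (hardy_norm p) bloch_norm K"
    and E: "op_norm (hardy_norm p) bloch_norm (\<lambda>f z. T f z - K f z) \<le> ennreal E" "0 \<le> E" and e: "0 < e"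
  obtains \<delta> where "\<delta> < 1" "weights_le (1 / p) \<delta> (48 * (2 * E + e))"
proof -
  obtain M where M: "weights_le (1 / p) (- 1) M" "0 \<le> M"
    using weights_le_if_bounded_op[OF p T] by blast
  have T': "\<And>f. f \<in> fspace (hardy_norm p) \<Longrightarrow> T f \<in> fspace bloch_norm"
    using T by (auto simp: bounded_op_def linear_op_def)
  have s: "0 < 1 / p" using p by simp
  obtain \<delta> where \<delta>: "\<delta> < 1" "\<And>z f. z \<in> unit_disc \<Longrightarrow> \<delta> < norm (\<phi> z) \<Longrightarrow> f \<in> fspace (hardy_norm p) \<Longrightarrow>
      hardy_norm p f \<le> 1 \<Longrightarrow> \<exists>B. \<forall>w\<in>unit_disc. norm (f w) \<le> B \<and> norm (deriv f w) \<le> B \<Longrightarrow>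
      (1 - (norm z)\<^sup>2) * norm (deriv (T f) z) \<le> 2 * E + e"
    using test_le_op_norm_diff[OF M s K T' E e] by blast
  have "weights_le (1 / p) \<delta> (48 * (2 * E + e))"
    unfolding weights_le_def
    by (intro ballI impI conjI weights_le_of_test[OF p] \<delta>(2)) auto
  then show ?thesis using \<delta>(1) that by blast
qed

text \<open>Dilated functions see only the disc of radius \<open>r\<close>, on which Montel's
  theorem gives uniform convergence together with derivatives. Bounded weights therefore
  suffice.\<close>

lemma compact_op_T_dilate:
  assumes p: "1 \<le> p" and M: "weights_le (1 / p) (- 1) M" "0 \<le> M" and r: "0 \<le> r" "r < 1"
  shows "compact_op (hardy_norm p) bloch_norm (\<lambda>f. T (\<lambda>w. f (of_real r * w)))"
  unfolding compact_op_def
proof (intro conjI allI impI)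
  have s: "0 < 1 / p" "0 \<le> 1 / p" "1 / p \<le> 1" using p by auto
  have gr: "growth (1 / p) (16 * enn2real (hardy_norm p f)) f"
    if "f \<in> fspace (hardy_norm p)" for f
    using that by (intro hardy_growth[OF p]) (auto simp: fspace_def)
  have "T (\<lambda>w. f (of_real r * w)) \<in> fspace bloch_norm" if "f \<in> fspace (hardy_norm p)" for f
    by (rule T_in_bloch[OF growth_dilate[OF gr[OF that]] _ M]) (use r s in auto)
  then show "linear_op (hardy_norm p) bloch_norm (\<lambda>f. T (\<lambda>w. f (of_real r * w)))"
    unfolding linear_op_def by (auto simp: weighted_comp_def algebra_simps)
  fix F :: "nat \<Rightarrow> complex \<Rightarrow> complex"
  assume F: "\<forall>n. F n \<in> fspace (hardy_norm p) \<and> hardy_norm p (F n) \<le> 1"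
  have grF: "growth (1 / p) (16 * 1) (F n)" for n
    using F by (intro hardy_growth[OF p]) auto
  obtain g \<sigma> where g: "growth (1 / p) (4 * (16 * 1)) g" and \<sigma>: "strict_mono (\<sigma> :: nat \<Rightarrow> nat)"
    and lim: "\<And>d e. d < 1 \<Longrightarrow> 0 < e \<Longrightarrow> \<forall>\<^sub>F n in sequentially. \<forall>w. norm w \<le> d \<longrightarrow>
      norm (F (\<sigma> n) w - g w) \<le> e \<and> norm (deriv (\<lambda>w. F (\<sigma> n) w - g w) w) \<le> e"
    by (rule growth_Montel[of "1 / p" "16 * 1" F]) (use grF s in auto)
  define h where "h = (\<lambda>n w. F (\<sigma> n) w - g w)"
  have h: "growth (1 / p) (16 * 1 + 4 * (16 * 1)) (h n)" for n
    unfolding h_def by (intro growth_diff grF g)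
  have Tg: "T (\<lambda>w. g (of_real r * w)) \<in> fspace bloch_norm"
    by (rule T_in_bloch[OF growth_dilate[OF g] _ M]) (use r s in auto)
  define c where "c = norm (u 0) + 2 * M"
  have c: "0 \<le> c" using M by (simp add: c_def)
  have "(\<lambda>n. bloch_norm (\<lambda>z. T (\<lambda>w. F (\<sigma> n) (of_real r * w)) z - T (\<lambda>w. g (of_real r * w)) z)) \<longlonglongrightarrow> 0"
    unfolding T_diff
  proof (rule tendsto_0_if_le_ennreal)
    fix e :: real assume e: "0 < e"
    \<comment> \<open>The summand 1 avoids division by zero when \<open>c = 0\<close>.\<close>
    define \<eta> where "\<eta> = e / (c + 1)"
    have \<eta>: "0 < \<eta>" "c * \<eta> \<le> e" using e c by (auto simp: \<eta>_def field_simps)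
    show "\<forall>\<^sub>F n in sequentially.
        bloch_norm (T (\<lambda>w. F (\<sigma> n) (of_real r * w) - g (of_real r * w))) \<le> ennreal e"
      using lim[OF r(2) \<eta>(1)]
    proof (rule eventually_mono)
      fix n assume small: "\<forall>w. norm w \<le> r \<longrightarrow>
        norm (F (\<sigma> n) w - g w) \<le> \<eta> \<and> norm (deriv (\<lambda>w. F (\<sigma> n) w - g w) w) \<le> \<eta>"
      have rw: "norm (of_real r * w) \<le> r" if "w \<in> unit_disc" for w
        using that r by (simp add: norm_mult mult_left_le)
      have sm: "norm (h n (of_real r * w)) \<le> \<eta>" "norm (deriv (\<lambda>w. h n (of_real r * w)) w) \<le> \<eta>"
        if w: "w \<in> unit_disc" for w
      proof -
        show "norm (h n (of_real r * w)) \<le> \<eta>" using small rw[OF w] by (simp add: h_def)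
        have "norm (deriv (\<lambda>w. h n (of_real r * w)) w) = r * norm (deriv (h n) (of_real r * w))"
          using h[of n] r w by (subst deriv_dilate) (auto simp: growth_def norm_mult)
        also have "\<dots> \<le> 1 * \<eta>"
          using small rw[OF w] r by (intro mult_mono) (auto simp: h_def)
        finally show "norm (deriv (\<lambda>w. h n (of_real r * w)) w) \<le> \<eta>" by simp
      qed
      have "bloch_norm (T (\<lambda>w. h n (of_real r * w))) \<le>
          ennreal (norm (u 0) * \<eta> + (2 * (16 * 1 + 4 * (16 * 1)) * 0 + 2 * M * \<eta>))"
      proof (rule bloch_norm_T_le[where \<delta> = 1])
        show "growth (1 / p) (16 * 1 + 4 * (16 * 1)) (\<lambda>w. h n (of_real r * w))"
          using r s by (intro growth_dilate h) auto
        show "norm (h n (of_real r * \<phi> 0)) \<le> \<eta>" by (rule sm) (rule \<phi>_in_disc, simp)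
        show "WI z * (1 - norm (\<phi> z)) powr - (1 + 1 / p) \<le> 0 \<and> WJ z * (1 - norm (\<phi> z)) powr - (1 / p) \<le> 0"
          if "z \<in> unit_disc" "1 < norm (\<phi> z)" for z using that norm_\<phi>[of z] by linarith
      qed (use M \<eta> sm weights_le_bound[OF M(1) s(1) _ M(2)] in auto)
      also have "norm (u 0) * \<eta> + (2 * (16 * 1 + 4 * (16 * 1)) * 0 + 2 * M * \<eta>) = c * \<eta>"
        by (simp add: c_def algebra_simps)
      finally show "bloch_norm (T (\<lambda>w. F (\<sigma> n) (of_real r * w) - g (of_real r * w))) \<le> ennreal e"
        using \<eta>(2) by (auto simp: h_def intro: order_trans ennreal_leI)
    qed
  qed
  then show "\<exists>g\<in>fspace bloch_norm. \<exists>s. strict_mono s \<and>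
      (\<lambda>n. bloch_norm (\<lambda>z. T (\<lambda>w. F (s n) (of_real r * w)) z - g z)) \<longlonglongrightarrow> 0"
    using Tg \<sigma> by blast
qed

text \<open>Without dilation, the limit function is close only on smaller discs; the missing region
  near the boundary is covered by weights that are arbitrarily small there.\<close>

lemma compact_op_T_if:
  assumes p: "1 \<le> p" and M: "weights_le (1 / p) (- 1) M" "0 \<le> M"
    and little: "\<And>L. 0 < L \<Longrightarrow> \<exists>\<delta><1. weights_le (1 / p) \<delta> L"
  shows "compact_op (hardy_norm p) bloch_norm T"
  unfolding compact_op_def
proof (intro conjI allI impI)
  have s: "0 < 1 / p" "0 \<le> 1 / p" "1 / p \<le> 1" using p by auto
  show "linear_op (hardy_norm p) bloch_norm T"
    using bounded_op_T_if[OF p M] by (simp add: bounded_op_def)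
  fix F :: "nat \<Rightarrow> complex \<Rightarrow> complex"
  assume F: "\<forall>n. F n \<in> fspace (hardy_norm p) \<and> hardy_norm p (F n) \<le> 1"
  have grF: "growth (1 / p) (16 * 1) (F n)" for n
    using F by (intro hardy_growth[OF p]) auto
  obtain g \<sigma> where g: "growth (1 / p) (4 * (16 * 1)) g" and \<sigma>: "strict_mono (\<sigma> :: nat \<Rightarrow> nat)"
    and lim: "\<And>d e. d < 1 \<Longrightarrow> 0 < e \<Longrightarrow> \<forall>\<^sub>F n in sequentially. \<forall>w. norm w \<le> d \<longrightarrow>
      norm (F (\<sigma> n) w - g w) \<le> e \<and> norm (deriv (\<lambda>w. F (\<sigma> n) w - g w) w) \<le> e"
    by (rule growth_Montel[of "1 / p" "16 * 1" F]) (use grF s in auto)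
  have Tg: "T g \<in> fspace bloch_norm"
    by (rule T_in_bloch[OF g _ M]) simp
  define c where "c = norm (u 0) + 2 * M"
  have c: "0 \<le> c" using M by (simp add: c_def)
  have "(\<lambda>n. bloch_norm (\<lambda>z. T (F (\<sigma> n)) z - T g z)) \<longlonglongrightarrow> 0"
    unfolding T_diff
  proof (rule tendsto_0_if_le_ennreal)
    fix e :: real assume e: "0 < e"
    define \<eta> where "\<eta> = e / (2 * (c + 1))"
    have \<eta>: "0 < \<eta>" "c * \<eta> \<le> e / 2" using e c by (auto simp: \<eta>_def field_simps)
    \<comment> \<open>The difference from the limit has growth constant \<open>16 + 64 = 80\<close>,
      so the far region costs \<open>2 * 80 * (e / 320) = e / 2\<close>.\<close>
    obtain \<delta>' where \<delta>': "\<delta>' < 1" "weights_le (1 / p) \<delta>' (e / 320)"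
      using little[of "e / 320"] e by auto
    \<comment> \<open>The Bloch norm also contains the value at the origin; enlarging the threshold
      puts \<open>\<phi> 0\<close> into the region where the difference is small.\<close>
    define \<delta> where "\<delta> = max \<delta>' (norm (\<phi> 0))"
    have \<delta>: "\<delta> < 1" "\<delta>' \<le> \<delta>" "norm (\<phi> 0) \<le> \<delta>"
      using \<delta>' norm_\<phi>[of 0] by (auto simp: \<delta>_def)
    show "\<forall>\<^sub>F n in sequentially. bloch_norm (T (\<lambda>w. F (\<sigma> n) w - g w)) \<le> ennreal e"
      using lim[OF \<delta>(1) \<eta>(1)]
    proof (rule eventually_mono)
      fix n assume small: "\<forall>w. norm w \<le> \<delta> \<longrightarrow>
        norm (F (\<sigma> n) w - g w) \<le> \<eta> \<and> norm (deriv (\<lambda>w. F (\<sigma> n) w - g w) w) \<le> \<eta>"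
      have "bloch_norm (T (\<lambda>w. F (\<sigma> n) w - g w)) \<le>
          ennreal (norm (u 0) * \<eta> + (2 * (16 * 1 + 4 * (16 * 1)) * (e / 320) + 2 * M * \<eta>))"
      proof (rule bloch_norm_T_le[where \<delta> = \<delta>])
        show "growth (1 / p) (16 * 1 + 4 * (16 * 1)) (\<lambda>w. F (\<sigma> n) w - g w)"
          by (intro growth_diff grF g)
        show "WI z * (1 - norm (\<phi> z)) powr - (1 + 1 / p) \<le> e / 320 \<and>
            WJ z * (1 - norm (\<phi> z)) powr - (1 / p) \<le> e / 320"
          if "z \<in> unit_disc" "\<delta> < norm (\<phi> z)" for z
          using \<delta>'(2) that \<delta>(2) by (auto simp: weights_le_def)
      qed (use e \<delta> M \<eta> small weights_le_bound[OF M(1) s(1) _ M(2)] in auto)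
      also have "norm (u 0) * \<eta> + (2 * (16 * 1 + 4 * (16 * 1)) * (e / 320) + 2 * M * \<eta>) = c * \<eta> + e / 2"
        by (simp add: c_def algebra_simps)
      also have "ennreal (c * \<eta> + e / 2) \<le> ennreal e"
        using \<eta>(2) by (intro ennreal_leI) simp
      finally show "bloch_norm (T (\<lambda>w. F (\<sigma> n) w - g w)) \<le> ennreal e" .
    qed
  qed
  then show "\<exists>g\<in>fspace bloch_norm. \<exists>s. strict_mono s \<and> (\<lambda>n. bloch_norm (\<lambda>z. T (F (s n)) z - g z)) \<longlonglongrightarrow> 0"
    using Tg \<sigma> by blast
qed

text \<open>The competitors are the dilated operators. The differences \<open>f - f(r w)\<close>
  keep the growth constant \<open>16 + 16 = 32\<close> however close \<open>r\<close> is to 1, and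
  twice this is 64; the contribution of the near region disappears as \<open>r\<close> tends to
  1.\<close>

lemma ess_norm_T_le:
  assumes p: "1 \<le> p" and M: "weights_le (1 / p) (- 1) M" "0 \<le> M"
    and L: "weights_le (1 / p) \<delta>' L" "\<delta>' < 1" "0 \<le> L"
  shows "ess_norm (hardy_norm p) bloch_norm T \<le> ennreal (64 * L)"
proof (rule ennreal_le_epsilon)
  fix e :: real assume e: "0 < e"
  have s: "0 < 1 / p" "0 \<le> 1 / p" "1 / p \<le> 1" using p by auto
  define \<delta> where "\<delta> = max \<delta>' (norm (\<phi> 0))"
  have \<delta>: "\<delta> < 1" "\<delta>' \<le> \<delta>" "norm (\<phi> 0) \<le> \<delta>"
    using L norm_\<phi>[of 0] by (auto simp: \<delta>_def)
  define c where "c = norm (u 0) + 2 * M"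
  have c: "0 \<le> c" using M by (simp add: c_def)
  define \<eta> where "\<eta> = e / (c + 1)"
  have \<eta>: "0 < \<eta>" "c * \<eta> \<le> e" using e c by (auto simp: \<eta>_def field_simps)
  \<comment> \<open>The order of choices: \<open>m\<close> is the closeness on radius
    \<open>d\<close> that Cauchy's inequality needs for \<open>\<eta>\<close> on radius
    \<open>\<delta>\<close>, \<open>Y\<close> is the constant of \<open>dilate_diff_le\<close> at
    \<open>d\<close>, and \<open>r\<close> is taken so that
    \<open>Y * (1 - r) \<le> m\<close>.\<close>
  define d where "d = (1 + \<delta>) / 2"
  have d: "d < 1" using \<delta> by (simp add: d_def)
  define m where "m = min \<eta> (\<eta> * (1 - \<delta>) / 2)"
  have m: "0 < m" "m \<le> \<eta>" "2 * m / (1 - \<delta>) \<le> \<eta>"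
    using \<delta> \<eta> by (auto simp: m_def min_def field_simps)
  define Y where "Y = 16 * 1 * (1 - d) powr - (1 + 1 / p)"
  have Y: "0 < Y" using d by (simp add: Y_def)
  define r where "r = max 0 (1 - m / Y)"
  have r: "0 \<le> r" "r < 1" "r \<le> 1" using m Y by (auto simp: r_def)
  have "Y * (1 - r) \<le> Y * (m / Y)" using Y by (intro mult_left_mono) (auto simp: r_def)
  then have Yr: "Y * (1 - r) \<le> m" using Y by simp
  have "bloch_norm (\<lambda>z. T f z - T (\<lambda>w. f (of_real r * w)) z) \<le> ennreal (64 * L + e)"
    if f: "f \<in> fspace (hardy_norm p)" "hardy_norm p f \<le> 1" for f
  proof -
    have gf: "growth (1 / p) (16 * 1) f" using f by (intro hardy_growth[OF p]) auto
    have gd: "growth (1 / p) (16 * 1 + 16 * 1) (\<lambda>w. f w - f (of_real r * w))"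
      using r s by (intro growth_diff growth_dilate gf) auto
    have le: "norm (f w - f (of_real r * w)) \<le> m" if "norm w \<le> d" for w
      using dilate_diff_le[OF gf r(1,3) s(2) _ that d] Yr by (simp add: Y_def)
    have "bloch_norm (T (\<lambda>w. f w - f (of_real r * w))) \<le>
        ennreal (norm (u 0) * \<eta> + (2 * (16 * 1 + 16 * 1) * L + 2 * M * \<eta>))"
    proof (rule bloch_norm_T_le[OF gd, where \<delta> = \<delta>])
      show small: "norm (f w - f (of_real r * w)) \<le> \<eta> \<and> norm (deriv (\<lambda>w. f w - f (of_real r * w)) w) \<le> \<eta>"
        if w: "norm w \<le> \<delta>" for w
      proof
        have "norm (f w - f (of_real r * w)) \<le> m" using w \<delta>(1) by (intro le) (simp add: d_def)
        then show "norm (f w - f (of_real r * w)) \<le> \<eta>" using m by simp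
        have "norm (deriv (\<lambda>w. f w - f (of_real r * w)) w) \<le> 2 * m / (1 - \<delta>)"
          using gd w \<delta>(1) le by (intro norm_deriv_le_of_bound) (auto simp: growth_def d_def)
        then show "norm (deriv (\<lambda>w. f w - f (of_real r * w)) w) \<le> \<eta>" using m by simp
      qed
      show "norm (f (\<phi> 0) - f (of_real r * \<phi> 0)) \<le> \<eta>" using small[OF \<delta>(3)] by blast
      show "WI z * (1 - norm (\<phi> z)) powr - (1 + 1 / p) \<le> L \<and>
            WJ z * (1 - norm (\<phi> z)) powr - (1 / p) \<le> L"
        if "z \<in> unit_disc" "\<delta> < norm (\<phi> z)" for z
        using L that \<delta>(2) by (auto simp: weights_le_def)
    qed (use L M \<eta> weights_le_bound[OF M(1) s(1) _ M(2)] in auto)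
    also have "norm (u 0) * \<eta> + (2 * (16 * 1 + 16 * 1) * L + 2 * M * \<eta>) = 64 * L + c * \<eta>"
      by (simp add: c_def algebra_simps)
    also have "ennreal (64 * L + c * \<eta>) \<le> ennreal (64 * L + e)"
      using \<eta>(2) by (intro ennreal_leI) simp
    finally show ?thesis unfolding T_diff .
  qed
  then have "op_norm (hardy_norm p) bloch_norm (\<lambda>f z. T f z - T (\<lambda>w. f (of_real r * w)) z) \<le> ennreal (64 * L + e)"
    unfolding op_norm_def by (intro SUP_least) auto
  moreover have "ess_norm (hardy_norm p) bloch_norm T \<le>
      op_norm (hardy_norm p) bloch_norm (\<lambda>f z. T f z - T (\<lambda>w. f (of_real r * w)) z)"
    unfolding ess_norm_def
    by (rule INF_lower2[of "\<lambda>f. T (\<lambda>w. f (of_real r * w))"]) (use compact_op_T_dilate[OF p M r(1,2)] in auto)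
  ultimately have "ess_norm (hardy_norm p) bloch_norm T \<le> ennreal (64 * L + e)" by simp
  then show "ess_norm (hardy_norm p) bloch_norm T \<le> ennreal (64 * L) + ennreal e"
    using L e by (simp add: ennreal_plus)
qed

end

lemma exp_mult_powr_self_pos:
  fixes p :: real
  assumes "1 \<le> p"
  shows "0 < exp 1 * (1 + 1 / p) powr (1 + 1 / p)"
proof -
  have "0 < 1 + 1 / p" using assms by (simp add: add_pos_pos)
  then show ?thesis by (intro mult_pos_pos) auto
qed

section \<open>From the weights to the sequences in \<open>j\<close>: boundedness, compactness,
  essential norm\<close>

context weighted_composition
begin

definition SI :: "real \<Rightarrow> nat \<Rightarrow> ennreal" where
  "SI s j = ennreal (real j powr s) * bloch_norm (I_op u (\<lambda>z. \<phi> z ^ j))"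

definition SJ :: "real \<Rightarrow> nat \<Rightarrow> ennreal" where
  "SJ s j = ennreal (real j powr s) * bloch_norm (J_op u (\<lambda>z. \<phi> z ^ (j - 1)))"

lemma SUP_SI_SJ_finite_iff:
  assumes s: "0 < s"
  shows "(SUP j\<in>{1..}. SI s j) < \<infinity> \<and> (SUP j\<in>{1..}. SJ s j) < \<infinity> \<longleftrightarrow>
    (\<exists>M\<ge>0. weights_le s (- 1) M)"
proof -
  have I: "(SUP j\<in>{1..}. SI s j) < \<infinity> \<longleftrightarrow>
      (\<exists>B\<ge>0. \<forall>z\<in>unit_disc. WI z * (1 - norm (\<phi> z)) powr - (1 + s) \<le> B)"
    unfolding SI_def bloch_norm_I_op[OF s]
    by (rule SUP_powr_power_finite_iff) (use s W_nonneg norm_\<phi> in auto)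
  have J: "(SUP j\<in>{1..}. SJ s j) < \<infinity> \<longleftrightarrow>
      (\<exists>B\<ge>0. \<forall>z\<in>unit_disc. WJ z * (1 - norm (\<phi> z)) powr - s \<le> B)"
    unfolding SJ_def bloch_norm_J_op
    by (rule SUP_powr_power_finite_iff) (use s W_nonneg norm_\<phi> in auto)
  have n: "- 1 < norm (\<phi> z)" for z using norm_ge_zero[of "\<phi> z"] by linarith
  show ?thesis
    unfolding I J weights_le_def
  proof (intro iffI; elim conjE exE)
    fix A B assume "0 \<le> A" "0 \<le> B"
      "\<forall>z\<in>unit_disc. WI z * (1 - norm (\<phi> z)) powr - (1 + s) \<le> A"
      "\<forall>z\<in>unit_disc. WJ z * (1 - norm (\<phi> z)) powr - s \<le> B"
    then show "\<exists>M\<ge>0. \<forall>z\<in>unit_disc. - 1 < norm (\<phi> z) \<longrightarrow>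
        WI z * (1 - norm (\<phi> z)) powr - (1 + s) \<le> M \<and> WJ z * (1 - norm (\<phi> z)) powr - s \<le> M"
      by (intro exI[of _ "max A B"]) (auto simp: le_max_iff_disj)
  qed (use n in blast)
qed

lemma weights_le_of_limsup:
  assumes s: "0 < s" and L: "limsup (SI s) < ennreal L" "limsup (SJ s) < ennreal L"
  shows "\<exists>\<delta><1. weights_le s \<delta> (exp 1 * 2 powr (1 + s) * L)"
proof -
  have "0 < ennreal L" using L(1) by (rule le_less_trans[rotated]) simp
  then have L0: "0 < L" by simp
  have "\<exists>\<delta><1. \<forall>z\<in>unit_disc. \<delta> < norm (\<phi> z) \<longrightarrow>
      WI z * (1 - norm (\<phi> z)) powr - (1 + s) \<le> exp 1 * 2 powr (1 + s) * L"
    by (rule limsup_powr_power_lower[OF _ W_nonneg(1) norm_\<phi> L(1)[unfolded SI_def bloch_norm_I_op[OF s]]])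
      (use s in auto)
  then obtain \<delta>1 where \<delta>1: "\<delta>1 < 1" "\<And>z. z \<in> unit_disc \<Longrightarrow> \<delta>1 < norm (\<phi> z) \<Longrightarrow>
      WI z * (1 - norm (\<phi> z)) powr - (1 + s) \<le> exp 1 * 2 powr (1 + s) * L"
    by blast
  have "\<exists>\<delta><1. \<forall>z\<in>unit_disc. \<delta> < norm (\<phi> z) \<longrightarrow>
      WJ z * (1 - norm (\<phi> z)) powr - s \<le> exp 1 * 2 powr s * L"
    by (rule limsup_powr_power_lower[OF s W_nonneg(2) norm_\<phi> L(2)[unfolded SJ_def bloch_norm_J_op]])
  then obtain \<delta>2 where \<delta>2: "\<delta>2 < 1" "\<And>z. z \<in> unit_disc \<Longrightarrow> \<delta>2 < norm (\<phi> z) \<Longrightarrow>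
      WJ z * (1 - norm (\<phi> z)) powr - s \<le> exp 1 * 2 powr s * L"
    by blast
  have "exp 1 * 2 powr s * L \<le> exp 1 * 2 powr (1 + s) * L"
    using L0 by (intro mult_right_mono mult_left_mono powr_mono) auto
  then have "weights_le s (max \<delta>1 \<delta>2) (exp 1 * 2 powr (1 + s) * L)"
    unfolding weights_le_def using \<delta>1(2) order_trans[OF \<delta>2(2)] by simp
  then show ?thesis using \<delta>1 \<delta>2 by (intro exI[of _ "max \<delta>1 \<delta>2"]) auto
qed

lemma limsup_le_of_weights:
  assumes s: "0 < s" and M: "weights_le s (- 1) M" "0 \<le> M"
    and L: "weights_le s \<delta> L" "\<delta> < 1" "0 \<le> L"
  shows "max (limsup (SI s)) (limsup (SJ s)) \<le> ennreal (exp 1 * (1 + s) powr (1 + s) * L)"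
proof -
  have "limsup (SI s) \<le> ennreal (exp 1 * (1 + s) powr (1 + s) * L)"
    unfolding SI_def bloch_norm_I_op[OF s]
    by (rule limsup_powr_power_upper[of _ _ _ M _ _ \<delta>])
      (use s L norm_\<phi> W_nonneg weights_le_bound[OF M(1) s _ M(2)] in \<open>auto simp: weights_le_def\<close>)
  moreover have "limsup (SJ s) \<le> ennreal (exp 1 * s powr s * L)"
    unfolding SJ_def bloch_norm_J_op
    by (rule limsup_powr_power_upper[of _ _ _ M _ _ \<delta>])
      (use s L norm_\<phi> W_nonneg weights_le_bound[OF M(1) s _ M(2)] in \<open>auto simp: weights_le_def\<close>)
  moreover have "ennreal (exp 1 * s powr s * L) \<le> ennreal (exp 1 * (1 + s) powr (1 + s) * L)"
  proof (intro ennreal_leI mult_right_mono mult_left_mono)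
    have "s powr s \<le> (1 + s) powr s" using s by (intro powr_mono2) auto
    also have "\<dots> \<le> (1 + s) powr (1 + s)" using s by (intro powr_mono) auto
    finally show "s powr s \<le> (1 + s) powr (1 + s)" .
  qed (use L in auto)
  ultimately show ?thesis by (meson max.boundedI order_trans)
qed

text \<open>Stated for a single compact \<open>K\<close> because it serves twice: the choice
  \<open>K = T\<close> gives the necessity of the limit conditions for compactness, and the infimum
  over \<open>K\<close> gives the lower bound of the essential norm.\<close>

lemma limsup_le_op_norm_diff:
  assumes p: "1 \<le> p" and T: "bounded_op (hardy_norm p) bloch_norm T"
    and K: "compact_op (hardy_norm p) bloch_norm K"
  shows "max (limsup (SI (1 / p))) (limsup (SJ (1 / p))) \<le>
    ennreal (96 * (exp 1 * (1 + 1 / p) powr (1 + 1 / p))) *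
      op_norm (hardy_norm p) bloch_norm (\<lambda>f z. T f z - K f z)" (is "_ \<le> ennreal (96 * ?c) * ?E")
proof (cases "?E = \<infinity>")
  case True
  \<comment> \<open>Since \<open>0 * top = 0\<close> in \<open>ennreal\<close>, the constant must be
    known to be nonzero.\<close>
  have "\<not> 96 * ?c \<le> 0" using exp_mult_powr_self_pos[OF p] by linarith
  then have "ennreal (96 * ?c) * ?E = \<infinity>" unfolding True by (simp only: ennreal_mult_top ennreal_eq_0_iff infinity_ennreal_def if_False)
  then show ?thesis by (simp only: infinity_ennreal_def top_greatest)
next
  case False
  define E where "E = enn2real ?E"
  have E: "?E = ennreal E" "0 \<le> E" using False by (auto simp: E_def top.not_eq_extremum)
  have s: "0 < 1 / p" using p by simp
  define c where "c = ?c"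
  have c: "0 < c" using exp_mult_powr_self_pos[OF p] by (simp only: c_def)
  obtain M where M: "weights_le (1 / p) (- 1) M" "0 \<le> M"
    using weights_le_if_bounded_op[OF p T] by blast
  have "max (limsup (SI (1 / p))) (limsup (SJ (1 / p))) \<le> ennreal (96 * c * E)"
  proof (rule ennreal_le_epsilon)
    fix e :: real assume e: "0 < e"
    \<comment> \<open>This slack is multiplied by \<open>48 * c\<close> below and becomes exactly
      \<open>e\<close>.\<close>
    have e': "0 < e / (48 * c)" using e c by simp
    obtain \<delta> where \<delta>: "\<delta> < 1" "weights_le (1 / p) \<delta> (48 * (2 * E + e / (48 * c)))"
      using weights_le_of_op_norm_diff[OF p T K eq_refl[OF E(1)] E(2) e'] by blast
    have "max (limsup (SI (1 / p))) (limsup (SJ (1 / p))) \<le>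
        ennreal (c * (48 * (2 * E + e / (48 * c))))"
      unfolding c_def
      by (rule limsup_le_of_weights[OF s M \<delta>(2,1)[unfolded c_def]])
        (use E(2) e' in \<open>simp add: c_def[symmetric]\<close>)
    also have "c * (48 * (2 * E + e / (48 * c))) = 96 * c * E + e"
      using c by (simp add: field_simps)
    also have "ennreal (96 * c * E + e) = ennreal (96 * c * E) + ennreal e"
      using c E(2) e by (intro ennreal_plus) auto
    finally show "max (limsup (SI (1 / p))) (limsup (SJ (1 / p))) \<le> ennreal (96 * c * E) + ennreal e" .
  qed
  also have "\<dots> = ennreal (96 * c) * ennreal E"
    using c E(2) by (intro ennreal_mult) auto
  finally show ?thesis by (simp only: E(1) c_def)
qed

lemma limsup_le_ess_norm:
  assumes p: "1 \<le> p" and T: "bounded_op (hardy_norm p) bloch_norm T"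
  shows "max (limsup (SI (1 / p))) (limsup (SJ (1 / p))) \<le>
    ennreal (96 * (exp 1 * (1 + 1 / p) powr (1 + 1 / p))) * ess_norm (hardy_norm p) bloch_norm T"
    (is "?m \<le> ennreal ?c * _")
proof -
  have c: "0 < ?c" using exp_mult_powr_self_pos[OF p] by simp
  \<comment> \<open>The constant is moved to the left so that the claim becomes a lower bound for an
    infimum.\<close>
  have "?m / ennreal ?c \<le> ess_norm (hardy_norm p) bloch_norm T"
    unfolding ess_norm_def
  proof (rule INF_greatest)
    fix K assume "K \<in> {K. compact_op (hardy_norm p) bloch_norm K}"
    then have "?m \<le> ennreal ?c * op_norm (hardy_norm p) bloch_norm (\<lambda>f z. T f z - K f z)"
      by (intro limsup_le_op_norm_diff[OF p T]) simp
    then show "?m / ennreal ?c \<le> op_norm (hardy_norm p) bloch_norm (\<lambda>f z. T f z - K f z)"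
      using c by (intro divide_le_posI_ennreal) auto
  qed
  then have "ennreal ?c * (?m / ennreal ?c) \<le> ennreal ?c * ess_norm (hardy_norm p) bloch_norm T"
    by (rule mult_left_mono) simp
  also have "ennreal ?c * (?m / ennreal ?c) = ?m"
  proof -
    have "ennreal ?c \<noteq> 0" using c by (simp only: ennreal_eq_0_iff not_le)
    then have "?m * ennreal ?c / ennreal ?c = ?m" by (rule mult_divide_eq_ennreal) (rule ennreal_neq_top)
    then show ?thesis by (simp only: ennreal_times_divide mult.commute)
  qed
  finally show ?thesis .
qed

lemma ess_norm_le_limsup:
  assumes p: "1 \<le> p" and T: "bounded_op (hardy_norm p) bloch_norm T"
  shows "ess_norm (hardy_norm p) bloch_norm T \<le>
    ennreal (64 * (exp 1 * 2 powr (1 + 1 / p))) * max (limsup (SI (1 / p))) (limsup (SJ (1 / p)))"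
    (is "_ \<le> ennreal (64 * ?c) * ?m")
proof (cases "?m = \<infinity>")
  case True
  then show ?thesis by (simp add: ennreal_mult_top)
next
  case False
  define m where "m = enn2real ?m"
  have m: "?m = ennreal m" "0 \<le> m" using False by (auto simp: m_def top.not_eq_extremum)
  have s: "0 < 1 / p" using p by simp
  have c: "0 < ?c" by simp
  obtain M where M: "weights_le (1 / p) (- 1) M" "0 \<le> M"
    using weights_le_if_bounded_op[OF p T] by blast
  have "ess_norm (hardy_norm p) bloch_norm T \<le> ennreal (64 * ?c * m)"
  proof (rule ennreal_le_epsilon)
    fix e :: real assume e: "0 < e"
    \<comment> \<open>\<open>weights_le_of_limsup\<close> needs a strict inequality; the excess over
      \<open>m\<close> is multiplied by \<open>64 * ?c\<close> below and becomes
      \<open>e\<close>.\<close>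
    define L where "L = m + e / (64 * ?c)"
    have L: "m < L" "0 < L" using e m(2) c by (auto simp: L_def intro: add_nonneg_pos)
    then have "?m < ennreal L" unfolding m(1) using m(2) by (intro ennreal_lessI) auto
    then obtain \<delta> where \<delta>: "\<delta> < 1" "weights_le (1 / p) \<delta> (?c * L)"
      using weights_le_of_limsup[OF s, of L] by auto
    have "ess_norm (hardy_norm p) bloch_norm T \<le> ennreal (64 * (?c * L))"
      by (rule ess_norm_T_le[OF p M \<delta>(2,1)]) (use L in simp)
    also have "64 * (?c * L) = 64 * ?c * m + e"
      using c unfolding L_def by (simp only: distrib_left) (simp add: field_simps)
    also have "ennreal (64 * ?c * m + e) = ennreal (64 * ?c * m) + ennreal e"
      using m(2) e by (intro ennreal_plus) auto
    finally show "ess_norm (hardy_norm p) bloch_norm T \<le> ennreal (64 * ?c * m) + ennreal e" .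
  qed
  also have "\<dots> = ennreal (64 * ?c) * ennreal m"
    using m(2) by (intro ennreal_mult) auto
  finally show ?thesis by (simp only: m(1))
qed

lemma bounded_op_T_iff:
  assumes p: "1 \<le> p"
  shows "bounded_op (hardy_norm p) bloch_norm T \<longleftrightarrow>
    (SUP j\<in>{1..}. SI (1 / p) j) < \<infinity> \<and> (SUP j\<in>{1..}. SJ (1 / p) j) < \<infinity>"
proof -
  have "0 < 1 / p" using p by simp
  note iff = SUP_SI_SJ_finite_iff[OF this]
  show ?thesis
    unfolding iff using bounded_op_T_if[OF p] weights_le_if_bounded_op[OF p] by blast
qed

lemma compact_op_T_iff:
  assumes p: "1 \<le> p" and T: "bounded_op (hardy_norm p) bloch_norm T"
  shows "compact_op (hardy_norm p) bloch_norm T \<longleftrightarrow>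
    limsup (SI (1 / p)) = 0 \<and> limsup (SJ (1 / p)) = 0"
proof
  assume K: "compact_op (hardy_norm p) bloch_norm T"
  \<comment> \<open>A compact \<open>T\<close> is its own compact approximation, with difference of
    norm 0.\<close>
  have "bloch_norm (\<lambda>z. 0) = 0" by (simp add: bloch_norm_def)
  then have "op_norm (hardy_norm p) bloch_norm (\<lambda>f z. T f z - T f z) \<le> 0"
    unfolding op_norm_def by (intro SUP_least) simp
  then have "op_norm (hardy_norm p) bloch_norm (\<lambda>f z. T f z - T f z) = 0"
    by (simp only: le_zero_eq)
  then have "max (limsup (SI (1 / p))) (limsup (SJ (1 / p))) \<le> 0"
    using limsup_le_op_norm_diff[OF p T K] by (simp only: mult_zero_right)
  then have "limsup (SI (1 / p)) \<le> 0 \<and> limsup (SJ (1 / p)) \<le> 0"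
    by (simp only: max.bounded_iff)
  then show "limsup (SI (1 / p)) = 0 \<and> limsup (SJ (1 / p)) = 0" by simp
next
  assume lim: "limsup (SI (1 / p)) = 0 \<and> limsup (SJ (1 / p)) = 0"
  have s: "0 < 1 / p" using p by simp
  obtain M where M: "weights_le (1 / p) (- 1) M" "0 \<le> M"
    using weights_le_if_bounded_op[OF p T] by blast
  show "compact_op (hardy_norm p) bloch_norm T"
  proof (rule compact_op_T_if[OF p M])
    fix L :: real assume L: "0 < L"
    have "0 < L / (exp 1 * 2 powr (1 + 1 / p))" using L by simp
    then have "\<exists>\<delta><1. weights_le (1 / p) \<delta> (exp 1 * 2 powr (1 + 1 / p) * (L / (exp 1 * 2 powr (1 + 1 / p))))"
      using lim by (intro weights_le_of_limsup[OF s]) auto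
    then show "\<exists>\<delta><1. weights_le (1 / p) \<delta> L" by simp
  qed
qed

end

theorem theorem3p4:
  fixes p :: real
  assumes "1 \<le> p"
  shows
    "(\<forall>u \<phi>. u holomorphic_on unit_disc \<and> \<phi> holomorphic_on unit_disc \<and>
        \<phi> ` unit_disc \<subseteq> unit_disc \<longrightarrow>
        (bounded_op (hardy_norm p) bloch_norm (weighted_comp u \<phi>) \<longleftrightarrow>
          (SUP j\<in>{1::nat..}. ennreal (real j powr (1 / p)) *
              bloch_norm (I_op u (\<lambda>z. \<phi> z ^ j))) < \<infinity> \<and>
          (SUP j\<in>{1::nat..}. ennreal (real j powr (1 / p)) *
              bloch_norm (J_op u (\<lambda>z. \<phi> z ^ (j - 1)))) < \<infinity>) \<and>
        (bounded_op (hardy_norm p) bloch_norm (weighted_comp u \<phi>) \<longrightarrow>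
          (compact_op (hardy_norm p) bloch_norm (weighted_comp u \<phi>) \<longleftrightarrow>
            limsup (\<lambda>j. ennreal (real j powr (1 / p)) *
              bloch_norm (I_op u (\<lambda>z. \<phi> z ^ j))) = 0 \<and>
            limsup (\<lambda>j. ennreal (real j powr (1 / p)) *
              bloch_norm (J_op u (\<lambda>z. \<phi> z ^ (j - 1)))) = 0))) \<and>
     (\<exists>C::real. C > 0 \<and>
       (\<forall>u \<phi>. u holomorphic_on unit_disc \<and> \<phi> holomorphic_on unit_disc \<and>
        \<phi> ` unit_disc \<subseteq> unit_disc \<and>
        bounded_op (hardy_norm p) bloch_norm (weighted_comp u \<phi>) \<longrightarrow>
          ess_norm (hardy_norm p) bloch_norm (weighted_comp u \<phi>) \<le>
            ennreal C * max
              (limsup (\<lambda>j. ennreal (real j powr (1 / p)) *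
                bloch_norm (I_op u (\<lambda>z. \<phi> z ^ j))))
              (limsup (\<lambda>j. ennreal (real j powr (1 / p)) *
                bloch_norm (J_op u (\<lambda>z. \<phi> z ^ (j - 1))))) \<and>
          max
              (limsup (\<lambda>j. ennreal (real j powr (1 / p)) *
                bloch_norm (I_op u (\<lambda>z. \<phi> z ^ j))))
              (limsup (\<lambda>j. ennreal (real j powr (1 / p)) *
                bloch_norm (J_op u (\<lambda>z. \<phi> z ^ (j - 1))))) \<le>
            ennreal C * ess_norm (hardy_norm p) bloch_norm (weighted_comp u \<phi>)))"
proof -
  \<comment> \<open>The larger of the constants of the two estimates; it depends on \<open>p\<close>
    only and is fixed before \<open>u\<close> and \<open>\<phi>\<close>.\<close>
  define C where "C = max (64 * (exp 1 * 2 powr (1 + 1 / p))) (96 * (exp 1 * (1 + 1 / p) powr (1 + 1 / p)))"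
  have C: "0 < C" by (simp add: C_def less_max_iff_disj)
  have wc: "weighted_composition u \<phi>"
    if "u holomorphic_on unit_disc" "\<phi> holomorphic_on unit_disc" "\<phi> ` unit_disc \<subseteq> unit_disc" for u \<phi>
    using that by unfold_locales
  have defs:
    "weighted_composition.SI u \<phi> s = (\<lambda>j. ennreal (real j powr s) * bloch_norm (I_op u (\<lambda>z. \<phi> z ^ j)))"
    "weighted_composition.SJ u \<phi> s = (\<lambda>j. ennreal (real j powr s) * bloch_norm (J_op u (\<lambda>z. \<phi> z ^ (j - 1))))"
    if "u holomorphic_on unit_disc" "\<phi> holomorphic_on unit_disc" "\<phi> ` unit_disc \<subseteq> unit_disc" for u \<phi> s
    using wc[OF that] by (auto simp: weighted_composition.SI_def weighted_composition.SJ_def)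
  have mono: "ennreal c * x \<le> ennreal C * x" if "c \<le> C" for c x
    using that by (intro mult_right_mono ennreal_leI) auto
  show ?thesis
  proof (intro conjI allI impI exI[of _ C] C; elim conjE)
    fix u \<phi> :: "complex \<Rightarrow> complex"
    assume *: "u holomorphic_on unit_disc" "\<phi> holomorphic_on unit_disc" "\<phi> ` unit_disc \<subseteq> unit_disc"
    note d = defs[OF *]
    show "bounded_op (hardy_norm p) bloch_norm (weighted_comp u \<phi>) \<longleftrightarrow>
          (SUP j\<in>{1::nat..}. ennreal (real j powr (1 / p)) * bloch_norm (I_op u (\<lambda>z. \<phi> z ^ j))) < \<infinity> \<and>
          (SUP j\<in>{1::nat..}. ennreal (real j powr (1 / p)) * bloch_norm (J_op u (\<lambda>z. \<phi> z ^ (j - 1)))) < \<infinity>"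
      using weighted_composition.bounded_op_T_iff[OF wc[OF *] assms] unfolding d .
    assume T: "bounded_op (hardy_norm p) bloch_norm (weighted_comp u \<phi>)"
    show "compact_op (hardy_norm p) bloch_norm (weighted_comp u \<phi>) \<longleftrightarrow>
            limsup (\<lambda>j. ennreal (real j powr (1 / p)) * bloch_norm (I_op u (\<lambda>z. \<phi> z ^ j))) = 0 \<and>
            limsup (\<lambda>j. ennreal (real j powr (1 / p)) * bloch_norm (J_op u (\<lambda>z. \<phi> z ^ (j - 1)))) = 0"
      using weighted_composition.compact_op_T_iff[OF wc[OF *] assms T] unfolding d .
  next
    fix u \<phi> :: "complex \<Rightarrow> complex"
    assume *: "u holomorphic_on unit_disc" "\<phi> holomorphic_on unit_disc" "\<phi> ` unit_disc \<subseteq> unit_disc"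
      and T: "bounded_op (hardy_norm p) bloch_norm (weighted_comp u \<phi>)"
    note d = defs[OF *]
    show "ess_norm (hardy_norm p) bloch_norm (weighted_comp u \<phi>) \<le> ennreal C * max
        (limsup (\<lambda>j. ennreal (real j powr (1 / p)) * bloch_norm (I_op u (\<lambda>z. \<phi> z ^ j))))
        (limsup (\<lambda>j. ennreal (real j powr (1 / p)) * bloch_norm (J_op u (\<lambda>z. \<phi> z ^ (j - 1)))))"
      by (rule order_trans[OF weighted_composition.ess_norm_le_limsup[OF wc[OF *] assms T, unfolded d] mono])
        (simp add: C_def)
    show "max (limsup (\<lambda>j. ennreal (real j powr (1 / p)) * bloch_norm (I_op u (\<lambda>z. \<phi> z ^ j))))
        (limsup (\<lambda>j. ennreal (real j powr (1 / p)) * bloch_norm (J_op u (\<lambda>z. \<phi> z ^ (j - 1))))) \<le>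
        ennreal C * ess_norm (hardy_norm p) bloch_norm (weighted_comp u \<phi>)"
      by (rule order_trans[OF weighted_composition.limsup_le_ess_norm[OF wc[OF *] assms T, unfolded d] mono])
        (simp add: C_def)
  qed
qed

end
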